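(* Let $Ax\le b$ be a description of a polyhedron $P\subseteq\mathbb{R}^2$ consisting of $m$ inequalities ($A\in\mathbb{Z}^{m\times2}$, $b\in\mathbb{Z}^m$). Then the split closure of $P$ admits a description (a finite system of linear inequalities with integer coefficients) whose size is polynomial in $m$, $\log\|A\|_\infty$ and $\log\|b\|_\infty$; that is, the size is bounded by a fixed polynomial, independent of the data, evaluated at these three quantities.
   Context: $\|\cdot\|_\infty$ is the maximum absolute value of the entries of a vector or matrix, and $\log z$ is read as $\log(2+z)$. An inequality description of a polyhedron $P\subseteq\mathbb{R}^2$ is a system $Ax\le b$ with $A\in\mathbb{Z}^{m\times2}$, $b\in\mathbb{Z}^m$ such that $P=\{x\in\mathbb{R}^2:Ax\le b\}$; its size is the number of bits needed to encode it, $O(m\log\|A\|_\infty+m\log\|b\|_\infty)$. For $\pi\in\mathbb{Z}^2\setminus\{0\}$ and $\pi_0\in\mathbb{Z}$, let $P^{\pi,\pi_0}:=\operatorname{conv}\big((P\cap\{x:\pi x\le\pi_0\})\cup(P\cap\{x:\pi x\ge\pi_0+1\})\big)$. The split closure of $P$ is $P^{\mathrm{split}}:=\bigcap_{\pi\in\mathbb{Z}^2\setminus\{0\},\,\pi_0\in\mathbb{Z}}P^{\pi,\pi_0}$. *)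

theory Defs
  imports "HOL-Analysis.Analysis" "HOL-Library.Log_Nat"
begin

definition real_vec :: "int^2 \<Rightarrow> real^2" where
  "real_vec a = (\<chi> i. real_of_int (a $ i))"

text \<open>
  A matrix with \<open>m\<close> rows and two columns is the list of its rows, so that \<open>m\<close> is an ordinary
  natural number (possibly 0) that a statement can quantify over.
\<close>

definition is_description :: "nat \<Rightarrow> (int^2) list \<Rightarrow> int list \<Rightarrow> (real^2) set \<Rightarrow> bool" where
  "is_description m A b P \<longleftrightarrow> length A = m \<and> length b = m \<and>
     P = {x. \<forall>i<m. real_vec (A ! i) \<bullet> x \<le> real_of_int (b ! i)}"

text \<open>The inserted 0 only matters for the empty system, whose norms are 0.\<close>

definition mat_norm_inf :: "(int^2) list \<Rightarrow> int" where
  "mat_norm_inf A = Max (insert 0 {\<bar>a $ j\<bar> | a j. a \<in> set A})"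

definition vec_norm_inf :: "int list \<Rightarrow> int" where
  "vec_norm_inf b = Max (insert 0 {\<bar>\<beta>\<bar> | \<beta>. \<beta> \<in> set b})"

text \<open>The logarithm, with the convention that \<open>log z\<close> is read as \<open>log (2 + z)\<close>.\<close>

definition log_plus2 :: "int \<Rightarrow> real" where
  "log_plus2 z = log 2 (2 + real_of_int z)"

text \<open>
  An integer is encoded by a sign bit followed by the binary digits of its absolute value
  (\<^term>\<open>bitlen 0 = 0\<close>), and a system by its coefficients and right-hand sides.
\<close>

definition int_bits :: "int \<Rightarrow> nat" where
  "int_bits z = 1 + nat (bitlen \<bar>z\<bar>)"

definition encoding_size :: "(int^2) list \<Rightarrow> int list \<Rightarrow> nat" where
  "encoding_size A b = (\<Sum>a\<leftarrow>A. \<Sum>j\<in>UNIV. int_bits (a $ j)) + (\<Sum>\<beta>\<leftarrow>b. int_bits \<beta>)"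

definition split_hull :: "(real^2) set \<Rightarrow> int^2 \<Rightarrow> int \<Rightarrow> (real^2) set" where
  "split_hull P \<pi> \<pi>0 = convex hull
     ((P \<inter> {x. real_vec \<pi> \<bullet> x \<le> real_of_int \<pi>0}) \<union>
      (P \<inter> {x. real_vec \<pi> \<bullet> x \<ge> real_of_int (\<pi>0 + 1)}))"

definition split_closure :: "(real^2) set \<Rightarrow> (real^2) set" where
  "split_closure P = (\<Inter>\<pi>\<in>UNIV - {0}. \<Inter>\<pi>0. split_hull P \<pi> \<pi>0)"

end

theory Submission
  imports Defs
begin

text \<open>
  Inside the strip of a split, a point lies in the split hull iff some line through it leaves the
  strip within the polyhedron; by Helly's theorem on the line this is a condition on pairs of
  inequalities. So the split closure is the intersection of the split closures of the half-planes
  (a single rounded inequality each) and of the cones spanned by two independent inequalities.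

  For a cone with determinant \<open>D\<close>, every split becomes an integer triple \<open>(P, Q, T)\<close> from a lattice
  \<open>L\<close> containing \<open>D\<close> times the standard lattice, and the split cuts off the apex iff \<open>0 < T < D\<close>. The
  cut is then \<open>c s + c' t \<ge> 1\<close> in the slacks \<open>s, t\<close>, where \<open>c = max (P / (D - T)) (- P / T)\<close> and
  similarly for \<open>c'\<close>. Reducing modulo \<open>D\<close> leaves finitely many cuts; choose a minimal family
  among them that implies the rest. Two members of this family never agree in the signs and bit
  lengths of \<open>P\<close>, \<open>Q\<close>, \<open>T\<close> and \<open>D - T\<close>: otherwise one of the triples \<open>2q - q'\<close>, \<open>2q' - q\<close> and
  \<open>q - q'\<close> (up to the order of \<open>q\<close> and \<open>q'\<close>) would yield a cut that makes \<open>q\<close> or \<open>q'\<close> redundant.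
  Hence the family has \<open>O(log D ^ 4)\<close> members.
\<close>

subsection \<open>Minimal families of cuts\<close>

text \<open>Take a dominating subset of least cardinality. Dropping \<open>c\<close> leaves some
  \<open>g\<close> undominated at some \<open>x\<close>; there \<open>c\<close> is the strict
  minimum within the subset and a minimum over \<open>G\<close>. Such points turn every later
  redundancy into a contradiction.\<close>

lemma minimal_dominating_subset:
  fixes f :: "'a \<Rightarrow> 'b \<Rightarrow> real"
  assumes "finite G"
  obtains S where "S \<subseteq> G"
    and "\<And>g x. g \<in> G \<Longrightarrow> x \<in> X \<Longrightarrow> \<exists>c\<in>S. f c x \<le> f g x"
    and "\<And>c. c \<in> S \<Longrightarrow> \<exists>x\<in>X. (\<forall>g\<in>G. f c x \<le> f g x) \<and> (\<forall>c'\<in>S - {c}. f c x < f c' x)"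
proof -
  define D where "D S \<longleftrightarrow> S \<subseteq> G \<and> (\<forall>g\<in>G. \<forall>x\<in>X. \<exists>c\<in>S. f c x \<le> f g x)" for S
  have "D G" unfolding D_def by auto
  then obtain S where S: "D S" "\<And>S'. D S' \<Longrightarrow> card S \<le> card S'"
    using ex_has_least_nat[of D G card] by blast
  have fin: "finite S" using S(1) assms finite_subset D_def by blast
  have "\<exists>x\<in>X. (\<forall>g\<in>G. f c x \<le> f g x) \<and> (\<forall>c'\<in>S - {c}. f c x < f c' x)" if c: "c \<in> S" for c
  proof -
    have "\<not> D (S - {c})" using S(2)[of "S - {c}"] card_Diff1_less[OF fin c] by auto
    then obtain g x where gx: "g \<in> G" "x \<in> X" "\<And>c'. c' \<in> S - {c} \<Longrightarrow> f g x < f c' x"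
      using S(1) unfolding D_def by (metis DiffD1 not_le subset_iff)
    have cg: "f c x \<le> f g x"
      using S(1) gx unfolding D_def by (metis Diff_iff not_le singletonD)
    have "f c x \<le> f g' x" if g': "g' \<in> G" for g'
    proof -
      obtain c1 where "c1 \<in> S" "f c1 x \<le> f g' x" using S(1) gx(2) g' unfolding D_def by blast
      then show ?thesis using gx(3)[of c1] cg by (cases "c1 = c") auto
    qed
    moreover have "\<forall>c'\<in>S - {c}. f c x < f c' x" using gx(3) cg by fastforce
    ultimately show ?thesis using gx(2) by blast
  qed
  then show ?thesis using that[of S] S(1) unfolding D_def by blast
qed

text \<open>For \<open>0 < T < D\<close> this is the reciprocal of the slack at which an edge of the
  cone leaves the strip \<open>0 < T + P * s < D\<close>: at \<open>(D - T) / P\<close> if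
  \<open>0 < P\<close>, at \<open>- T / P\<close> if \<open>P < 0\<close>, never if
  \<open>P = 0\<close>. So \<open>cut_value\<close> is the left side of the intersection
  cut.\<close>

definition cut_coeff :: "int \<Rightarrow> int \<Rightarrow> int \<Rightarrow> real" where
  "cut_coeff D T P = max (real_of_int P / real_of_int (D - T)) (- real_of_int P / real_of_int T)"

definition cut_value :: "int \<Rightarrow> int \<times> int \<times> int \<Rightarrow> real \<times> real \<Rightarrow> real" where
  "cut_value D q s = (case q of (P, Q, T) \<Rightarrow> cut_coeff D T P * fst s + cut_coeff D T Q * snd s)"

text \<open>Chosen so that \<open>x\<close>, \<open>y\<close>, \<open>2 * x - y\<close> and
  \<open>2 * y - x\<close> share one sign: extrapolating beyond either of two near numbers never
  crosses zero.\<close>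

definition near :: "int \<Rightarrow> int \<Rightarrow> bool" where
  "near x y \<longleftrightarrow> (x = 0 \<and> y = 0) \<or> (\<bar>x - y\<bar> < \<bar>x\<bar> \<and> \<bar>x - y\<bar> < \<bar>y\<bar>)"

lemma near_sym: "near x y \<Longrightarrow> near y x"
  unfolding near_def by auto

lemma near_minus: "near (- x) (- y) = near x y"
  unfolding near_def by auto

section \<open>Sign rules for cut coefficients\<close>

lemma cut_coeff_nonneg_arg:
  assumes "0 < T" "T < D" "0 \<le> P"
  shows "cut_coeff D T P = P / (D - T)"
proof -
  have "- real_of_int P / T \<le> 0" "0 \<le> P / real_of_int (D - T)" using assms by auto
  then show ?thesis unfolding cut_coeff_def by simp
qed

text \<open>\<open>(- P, - Q, D - T)\<close> is the triple of the same strip described by the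
  opposite normal. This symmetry halves the sign cases later on.\<close>

lemma cut_coeff_minus:
  "cut_coeff D (D - T) (- P) = cut_coeff D T P"
  unfolding cut_coeff_def by (simp add: max.commute)

lemma cut_coeff_nonpos_arg:
  assumes "0 < T" "T < D" "P \<le> 0"
  shows "cut_coeff D T P = - P / T"
  using cut_coeff_nonneg_arg[of "D - T" D "- P"] assms cut_coeff_minus[of D T P] by simp

lemma cut_coeff_mono:
  assumes "0 < T" "T < D" "\<bar>P\<bar> \<le> \<bar>P'\<bar>" "0 \<le> P \<and> 0 \<le> P' \<or> P \<le> 0 \<and> P' \<le> 0"
  shows "cut_coeff D T P \<le> cut_coeff D T P'"
  using assms by (auto simp: cut_coeff_nonneg_arg cut_coeff_nonpos_arg divide_right_mono)

text \<open>The cuts of \<open>q'\<close>, \<open>q\<close> and \<open>2q - q'\<close> are collinear, so the last one is an extrapolation.\<close>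

lemma reflected_cut_same_sign:
  assumes T: "0 < T" "T < D" "0 < T'" "T' < D" "2 * T - T' < D" "0 < 2 * T - T'"
    and P: "0 \<le> P" "0 \<le> P'" "0 \<le> 2 * P - P'"
    and Q: "0 \<le> Q" "0 \<le> Q'" "0 \<le> 2 * Q - Q'"
    and less: "cut_value D (P, Q, T) s < cut_value D (P', Q', T') s"
  shows "cut_value D (2 * P - P', 2 * Q - Q', 2 * T - T') s < cut_value D (P, Q, T) s"
proof -
  obtain x y where s: "s = (x, y)" by fastforce
  define n where "n A B = real_of_int A * x + real_of_int B * y" for A B
  have v: "cut_value D (A, B, U) s = n A B / (D - U)" if "0 < U" "U < D" "0 \<le> A" "0 \<le> B" for A B U
    using that by (simp add: cut_value_def cut_coeff_nonneg_arg s n_def add_divide_distrib)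
  have n: "n (2 * P - P') (2 * Q - Q') = 2 * n P Q - n P' Q'"
    by (simp add: n_def algebra_simps)
  define u u' where "u = real_of_int (D - T)" and "u' = real_of_int (D - T')"
  have u: "0 < u" "0 < u'" "0 < 2 * u - u'" using T by (auto simp: u_def u'_def)
  have u'': "real_of_int (D - (2 * T - T')) = 2 * u - u'" by (simp add: u_def u'_def)
  have "n P Q / u < n P' Q' / u'"
    using less v[of T P Q] v[of T' P' Q'] T P Q by (simp add: u_def u'_def)
  then have "n P Q * u' < n P' Q' * u" using u by (simp add: field_simps)
  \<comment> \<open>\<open>n P Q / u\<close> is the mediant of \<open>n P' Q' / u'\<close> and the
    reflected quotient, hence lies strictly between them.\<close>
  then have "(2 * n P Q - n P' Q') / (2 * u - u') < n P Q / u"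
    using u by (simp add: field_simps)
  moreover have "cut_value D (P, Q, T) s = n P Q / u" using v[of T P Q] T P Q by (simp add: u_def)
  moreover have "cut_value D (2 * P - P', 2 * Q - Q', 2 * T - T') s = (2 * n P Q - n P' Q') / (2 * u - u')"
    using v[of "2 * T - T'" "2 * P - P'" "2 * Q - Q'"] T P Q unfolding n u'' by simp
  ultimately show ?thesis by simp
qed

text \<open>
  For mixed signs the cuts of the pencil through \<open>q\<close> and \<open>q'\<close> lie on a branch of a hyperbola.
  If it is concave, \<open>2q - q'\<close> beats \<open>q\<close>; if it is convex, the difference \<open>q - q'\<close> beats \<open>q\<close>.
\<close>

lemma mixed_cuts_not_both_supporting:
  assumes T: "0 < T" "T < D" "0 < T'" "T' < D" "T' \<le> T"
    and near: "near T T'" "near (D - T) (D - T')" "near P P'" "near Q Q'"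
    and sign: "0 \<le> P" "0 \<le> P'" "Q \<le> 0" "Q' \<le> 0"
    and s: "0 \<le> fst s" "0 \<le> snd s" "cut_value D (P, Q, T) s < cut_value D (P', Q', T') s"
    and r: "0 \<le> fst r" "0 \<le> snd r" "cut_value D (P', Q', T') r < cut_value D (P, Q, T) r"
    and refl: "cut_value D (P, Q, T) s \<le> cut_value D (2 * P - P', 2 * Q - Q', 2 * T - T') s"
    and diff: "T' < T \<Longrightarrow> cut_value D (P, Q, T) s \<le> cut_value D (P - P', Q - Q', T - T') s"
  shows False
proof -
  define c1 c2 c1' c2' where c: "c1 = cut_coeff D T P" "c2 = cut_coeff D T Q"
    "c1' = cut_coeff D T' P'" "c2' = cut_coeff D T' Q'"
  obtain x y where xy: "s = (x, y)" "0 \<le> x" "0 \<le> y" using s by (cases s) auto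
  have vs: "c1 * x + c2 * y < c1' * x + c2' * y"
    using s(3) xy by (simp add: c cut_value_def)
  have vr: "c1' * fst r + c2' * snd r < c1 * fst r + c2 * snd r"
    using r(3) by (simp add: c cut_value_def)
  \<comment> \<open>The points \<open>r\<close> and \<open>s\<close> show that neither cut dominates
    the other coefficientwise, so the two coefficients change in opposite directions.\<close>
  have n1: "\<not> (c1 \<le> c1' \<and> c2 \<le> c2')"
    using vr r(1,2) mult_right_mono[of c1 c1' "fst r"] mult_right_mono[of c2 c2' "snd r"] by fastforce
  have n2: "\<not> (c1' \<le> c1 \<and> c2' \<le> c2)"
    using vs xy(2,3) mult_right_mono[of c1' c1 x] mult_right_mono[of c2' c2 y] by fastforce
  define p p' q q' t t' u u' where pq:
    "p = real_of_int P" "p' = real_of_int P'" "q = - real_of_int Q" "q' = - real_of_int Q'"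
    "t = real_of_int T" "t' = real_of_int T'" "u = real_of_int (D - T)" "u' = real_of_int (D - T')"
  have pos: "0 < t" "0 < t'" "0 < u" "0 < u'" "0 \<le> p" "0 \<le> p'" "0 \<le> q" "0 \<le> q'"
    using T sign by (auto simp: pq)
  have iT: "0 < 2 * T - T'" "2 * T - T' < D" "0 \<le> 2 * P - P'" "2 * Q - Q' \<le> 0"
    using near T sign unfolding near_def by auto
  have posr: "0 < 2 * t - t'" "0 < 2 * u - u'" using iT(1,2) by (auto simp: pq)
  have u'': "real_of_int (D - (2 * T - T')) = 2 * u - u'" by (simp add: pq)
  have cv: "c1 = p / u" "c2 = q / t" "c1' = p' / u'" "c2' = q' / t'"
    using T sign by (simp_all add: c pq cut_coeff_nonneg_arg cut_coeff_nonpos_arg)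
  have r1: "cut_coeff D (2 * T - T') (2 * P - P') = (2 * p - p') / (2 * u - u')"
    using cut_coeff_nonneg_arg[OF iT(1,2,3)] unfolding u'' by (simp add: pq)
  have r2: "cut_coeff D (2 * T - T') (2 * Q - Q') = (2 * q - q') / (2 * t - t')"
    using cut_coeff_nonpos_arg[OF iT(1,2,4)] by (simp add: pq)
  have refl': "c1 * x + c2 * y \<le> (2 * p - p') / (2 * u - u') * x + (2 * q - q') / (2 * t - t') * y"
    using refl unfolding cut_value_def xy by (simp add: r1 r2 c)
  have tu: "t - t' = u' - u" by (simp add: pq)
  \<comment> \<open>Compares the quotient at the extrapolated arguments with the extrapolated
    quotient. The sign of their difference is that of (change of quotient) times (change of
    denominator).\<close>
  have concave: "(2 * a - a') / (2 * w - w') \<le> 2 * (a / w) - a' / w'"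
    if w: "0 < w" "0 < w'" "0 < 2 * w - w'" and mono: "(a / w - a' / w') * (w - w') \<ge> 0"
    for a a' w w' :: real
  proof -
    have "2 * (a / w) - a' / w' - (2 * a - a') / (2 * w - w')
        = 2 * (a / w - a' / w') * (w - w') / (2 * w - w')"
      using w by (simp add: field_simps)
    moreover have "0 \<le> 2 * (a / w - a' / w') * (w - w') / (2 * w - w')"
      using w mono by (intro divide_nonneg_pos) (simp_all only: mult.assoc zero_le_mult_iff, simp_all)
    ultimately show ?thesis by linarith
  qed
  \<comment> \<open>If both coefficients lie below their linear extrapolations, the reflected cut
    has value at most \<open>2v - v' < v\<close> at \<open>s\<close>, where \<open>v < v'\<close>
    are the values of the two given cuts. This contradicts \<open>refl\<close>.\<close>
  have conc: False if "(c1 - c1') * (u - u') \<ge> 0" "(c2 - c2') * (t - t') \<ge> 0"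
  proof -
    have 1: "(2 * p - p') / (2 * u - u') \<le> 2 * c1 - c1'"
      using concave[of u u' p p'] that(1) pos posr by (simp add: cv)
    have 2: "(2 * q - q') / (2 * t - t') \<le> 2 * c2 - c2'"
      using concave[of t t' q q'] that(2) pos posr by (simp add: cv)
    have "(2 * p - p') / (2 * u - u') * x + (2 * q - q') / (2 * t - t') * y
       \<le> (2 * c1 - c1') * x + (2 * c2 - c2') * y"
      using 1 2 xy by (intro add_mono mult_right_mono) auto
    then show False using refl' vs by (simp add: algebra_simps)
  qed
  \<comment> \<open>Since \<open>t + u = t' + u'\<close>, the denominators change in opposite
    directions. In the second case each coefficient changes in the direction of its denominator,
    which is the concave situation; the third case is the convex one.\<close>
  consider "T = T'" | "T' < T" "c1 < c1'" "c2' < c2" | "T' < T" "c1' < c1" "c2 < c2'"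
    using n1 n2 T by linarith
  then show False
  proof cases
    case 1 then show False using conc tu by (simp add: pq)
  next
    case 2
    then have "t' < t" "u < u'" by (auto simp: pq)
    then show False using conc 2 by (simp add: mult_nonpos_nonpos)
  next
    case 3
    define \<tau> where "\<tau> = t - t'"
    have tau: "0 < \<tau>" "t' = t - \<tau>" "u' = u + \<tau>" using 3 tu by (auto simp: pq \<tau>_def)
    have p0: "0 < p"
    proof (rule ccontr)
      assume "\<not> 0 < p"
      then have "P = 0" "P' = 0" using sign near(3) by (auto simp: pq near_def)
      then show False using 3(2) by (simp add: cv pq)
    qed
    have q0: "0 < q"
    proof (rule ccontr)
      assume "\<not> 0 < q"
      then have "Q = 0" "Q' = 0" using sign near(4) by (auto simp: pq near_def)
      then show False using 3(3) by (simp add: cv pq)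
    qed
    have "\<bar>P - P'\<bar> < P" using near(3) sign p0 unfolding near_def pq by auto
    then have "real_of_int \<bar>P - P'\<bar> < real_of_int (P)" by (simp only: of_int_less_iff)
    then have dp: "\<bar>p - p'\<bar> < p" by (simp add: pq abs_minus_commute)
    have "\<bar>Q - Q'\<bar> < - Q" using near(4) sign q0 unfolding near_def pq by auto
    then have "real_of_int \<bar>Q - Q'\<bar> < real_of_int (- Q)" by (simp only: of_int_less_iff)
    then have dq: "\<bar>q - q'\<bar> < q" by (simp add: pq abs_minus_commute)
    \<comment> \<open>Each coefficient of the difference triple is a maximum of two quotients.
      \<open>e1\<close> and \<open>e2\<close> bound those with denominator \<open>T - T'\<close>, by
      cross-multiplying the assumptions of this case; \<open>f1\<close> and \<open>f2\<close> bound
      the other two.\<close>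
    have e1: "(p' - p) / \<tau> < c1" using 3(2) pos tau by (simp add: cv field_simps)
    have e2: "(q - q') / \<tau> < c2" using 3(3) pos tau unfolding cv by (simp add: field_simps)
    have dt: "real_of_int (D - (T - T')) = u + t'" by (simp add: pq)
    have le: "t \<le> u + t'" using iT(2) by (simp add: pq)
    have f1: "(p - p') / (u + t') < c1"
    proof -
      have "(p - p') / (u + t') < p / (u + t')" using dp pos by (intro divide_strict_right_mono) auto
      also have "\<dots> \<le> p / u" using pos by (intro divide_left_mono) auto
      finally show ?thesis by (simp add: cv)
    qed
    have f2: "(q' - q) / (u + t') < c2"
    proof -
      have "(q' - q) / (u + t') < q / (u + t')" using dq pos by (intro divide_strict_right_mono) auto
      also have "\<dots> \<le> q / t" using pos le by (intro divide_left_mono) auto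
      finally show ?thesis by (simp add: cv)
    qed
    have g1: "cut_coeff D (T - T') (P - P') < c1"
      using e1 f1 unfolding cut_coeff_def dt by (simp add: pq \<tau>_def)
    have g2: "cut_coeff D (T - T') (Q - Q') < c2"
      using e2 f2 unfolding cut_coeff_def dt by (simp add: pq \<tau>_def)
    have "cut_coeff D (T - T') (P - P') * x + cut_coeff D (T - T') (Q - Q') * y < c1 * x + c2 * y"
    \<comment> \<open>Strictness needs one positive slack, and \<open>vs\<close> excludes the
      origin.\<close>
    proof (cases "x = 0")
      case True
      then have "0 < y" using vs xy by (cases "y = 0") auto
      then show ?thesis using g2 True by simp
    next
      case False
      then show ?thesis using g1 g2 xy
        by (intro add_less_le_mono mult_strict_right_mono mult_right_mono) auto
    qed
    then show False using diff[OF 3(1)] by (simp add: cut_value_def xy c)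
  qed
qed

text \<open>Equal bit lengths put both absolute values into one dyadic interval from
  \<open>2 ^ k\<close> to \<open>2 ^ Suc k\<close>, so they differ by a factor less than two; the
  signs agree.\<close>

lemma near_if_signed_bitlen_eq:
  assumes "sgn x * bitlen \<bar>x\<bar> = sgn y * bitlen \<bar>y\<bar>"
  shows "near x y"
proof (cases "x = 0 \<or> y = 0")
  case True
  then show ?thesis using assms bitlen_eq_zero_iff[of "\<bar>x\<bar>"] bitlen_eq_zero_iff[of "\<bar>y\<bar>"]
    unfolding near_def by (auto simp: sgn_if split: if_splits)
next
  case False
  define k where "k = nat (bitlen \<bar>x\<bar> - 1)"
  have b: "0 < bitlen \<bar>x\<bar>" "0 < bitlen \<bar>y\<bar>"
    using False bitlen_nonneg bitlen_eq_zero_iff by (metis abs_le_zero_iff less_le)+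
  have sg: "sgn x = sgn y" "bitlen \<bar>x\<bar> = bitlen \<bar>y\<bar>"
    using assms b by (auto simp: sgn_if split: if_splits)
  have "2 ^ k \<le> \<bar>x\<bar>" "\<bar>x\<bar> < 2 ^ Suc k" "2 ^ k \<le> \<bar>y\<bar>" "\<bar>y\<bar> < 2 ^ Suc k"
    using bitlen_bounds[of "\<bar>x\<bar>"] bitlen_bounds[of "\<bar>y\<bar>"] False sg b
    by (auto simp: k_def nat_diff_distrib Suc_diff_1 simp flip: power_Suc)
  then have "\<bar>x\<bar> < 2 * \<bar>y\<bar>" "\<bar>y\<bar> < 2 * \<bar>x\<bar>" by auto
  then show ?thesis using sg(1) False unfolding near_def by (auto simp: sgn_if split: if_splits)
qed

text \<open>Division rounded towards zero. Keeping the sign of \<open>P\<close> matters: only then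
  does passing to the residue not increase the cut coefficient.\<close>

lemma signed_residue:
  fixes P D :: int
  assumes "0 < D"
  obtains k where "\<bar>P - D * k\<bar> < D" "\<bar>P - D * k\<bar> \<le> \<bar>P\<bar>"
    "0 \<le> P - D * k \<and> 0 \<le> P \<or> P - D * k \<le> 0 \<and> P \<le> 0"
proof (cases "0 \<le> P")
  case True
  have "P - D * (P div D) = P mod D" by (simp add: minus_mult_div_eq_mod)
  then show ?thesis using that[of "P div D"] True assms zmod_le_nonneg_dividend[of P D] by simp
next
  case False
  have "P - D * (- ((- P) div D)) = - ((- P) mod D)"
    using minus_mult_div_eq_mod[of "- P" D] by simp
  then show ?thesis
    using that[of "- ((- P) div D)"] False assms zmod_le_nonneg_dividend[of "- P" D] by simp
qed

text \<open>The members of a minimal family of reduced triples are told apart by four signed bit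
  lengths, and the bound counts the possible codes. Of the lattice only closure under differences
  and a few multiples of \<open>D\<close> are used.\<close>

lemma small_dominating_cut_family:
  fixes L :: "(int \<times> int \<times> int) set"
  assumes D: "0 < D"
    and L: "\<And>q q'. q \<in> L \<Longrightarrow> q' \<in> L \<Longrightarrow> q - q' \<in> L"
      "\<And>k. (D * k, 0, 0) \<in> L" "\<And>k. (0, D * k, 0) \<in> L" "(0, 0, D) \<in> L"
  obtains S where "finite S" "card S \<le> (2 * nat (bitlen D) + 1) ^ 4"
    and "\<And>P Q T. (P, Q, T) \<in> S \<Longrightarrow> (P, Q, T) \<in> L \<and> \<bar>P\<bar> < D \<and> \<bar>Q\<bar> < D \<and> 0 < T \<and> T < D"
    and "\<And>P Q T s. (P, Q, T) \<in> L \<Longrightarrow> 0 < T \<Longrightarrow> T < D \<Longrightarrow> 0 \<le> fst s \<Longrightarrow> 0 \<le> snd s \<Longrightarrow>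
      \<exists>c\<in>S. cut_value D c s \<le> cut_value D (P, Q, T) s"
proof -
  define X :: "(real \<times> real) set" where "X = {s. 0 \<le> fst s \<and> 0 \<le> snd s}"
  define F where "F = {(P, Q, T). (P, Q, T) \<in> L \<and> \<bar>P\<bar> < D \<and> \<bar>Q\<bar> < D \<and> 0 < T \<and> T < D}"
  have "F \<subseteq> {-D..D} \<times> {-D..D} \<times> {-D..D}" unfolding F_def by auto
  then have "finite F" using finite_subset by blast
  then obtain S where S: "S \<subseteq> F"
    "\<And>g x. g \<in> F \<Longrightarrow> x \<in> X \<Longrightarrow> \<exists>c\<in>S. cut_value D c x \<le> cut_value D g x"
    "\<And>c. c \<in> S \<Longrightarrow> \<exists>x\<in>X. (\<forall>g\<in>F. cut_value D c x \<le> cut_value D g x)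
       \<and> (\<forall>c'\<in>S - {c}. cut_value D c x < cut_value D c' x)"
    by (rule minimal_dominating_subset[where X = X and f = "cut_value D"]) blast
  \<comment> \<open>Signed residues of \<open>P\<close> and \<open>Q\<close> modulo \<open>D\<close>
    give a triple in \<open>F\<close> with the same \<open>T\<close> and no larger
    coefficients.\<close>
  have red: "\<exists>g\<in>F. \<forall>x\<in>X. cut_value D g x \<le> cut_value D (P, Q, T) x"
    if g: "(P, Q, T) \<in> L" "0 < T" "T < D" for P Q T
  proof -
    obtain k where k: "\<bar>P - D * k\<bar> < D" "\<bar>P - D * k\<bar> \<le> \<bar>P\<bar>"
      "0 \<le> P - D * k \<and> 0 \<le> P \<or> P - D * k \<le> 0 \<and> P \<le> 0"
      using signed_residue[OF D] .
    obtain l where l: "\<bar>Q - D * l\<bar> < D" "\<bar>Q - D * l\<bar> \<le> \<bar>Q\<bar>"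
      "0 \<le> Q - D * l \<and> 0 \<le> Q \<or> Q - D * l \<le> 0 \<and> Q \<le> 0"
      using signed_residue[OF D] .
    have "(P - D * k, Q - D * l, T) \<in> L"
      using L(1)[OF L(1)[OF g(1) L(2)[of k]] L(3)[of l]] by simp
    then have "(P - D * k, Q - D * l, T) \<in> F" using k(1) l(1) g by (simp add: F_def)
    moreover have "\<forall>x\<in>X. cut_value D (P - D * k, Q - D * l, T) x \<le> cut_value D (P, Q, T) x"
      unfolding cut_value_def X_def using cut_coeff_mono[OF g(2,3) k(2,3)] cut_coeff_mono[OF g(2,3) l(2,3)]
      by (auto intro!: add_mono mult_right_mono)
    ultimately show ?thesis by blast
  qed
  \<comment> \<open>Extends the supporting property from \<open>F\<close> to all admissible triples
    of \<open>L\<close>. The extrapolated triples used below need not be reduced.\<close>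
  have support: "\<exists>x\<in>X. (\<forall>P Q T. (P, Q, T) \<in> L \<longrightarrow> 0 < T \<longrightarrow> T < D \<longrightarrow> cut_value D c x \<le> cut_value D (P, Q, T) x)
       \<and> (\<forall>c'\<in>S - {c}. cut_value D c x < cut_value D c' x)" if c: "c \<in> S" for c
  proof -
    obtain x where x: "x \<in> X" "\<forall>g\<in>F. cut_value D c x \<le> cut_value D g x"
      "\<forall>c'\<in>S - {c}. cut_value D c x < cut_value D c' x"
      using S(3)[OF c] by blast
    have "cut_value D c x \<le> cut_value D (P, Q, T) x" if g: "(P, Q, T) \<in> L" "0 < T" "T < D" for P Q T
    proof -
      obtain g where "g \<in> F" "cut_value D g x \<le> cut_value D (P, Q, T) x" using red[OF g] x(1) by blast
      then show ?thesis using x(2) by fastforce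
    qed
    then show ?thesis using x by blast
  qed
  have neg: "(- P, - Q, D - T) \<in> L" if "(P, Q, T) \<in> L" for P Q T
    using L(1)[OF L(4) that] by simp
  have refl: "(2 * P - P', 2 * Q - Q', 2 * T - T') \<in> L" if q: "(P, Q, T) \<in> L" "(P', Q', T') \<in> L"
    for P Q T P' Q' T'
  proof -
    have "(P, Q, T) - ((P', Q', T') - (P, Q, T)) \<in> L" using L(1) q by blast
    then show ?thesis by (simp add: algebra_simps)
  qed
  define supports where "supports = (\<lambda>(P, Q, T) (P', Q', T').
     \<exists>x\<in>X. (\<forall>A B U. (A, B, U) \<in> L \<longrightarrow> 0 < U \<longrightarrow> U < D \<longrightarrow> cut_value D (P, Q, T) x \<le> cut_value D (A, B, U) x)
       \<and> cut_value D (P, Q, T) x < cut_value D (P', Q', T') x)"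
  have supp: "supports c c'" if c: "c \<in> S" "c' \<in> S" "c \<noteq> c'" for c c'
  proof -
    obtain x where "x \<in> X"
      "\<forall>P Q T. (P, Q, T) \<in> L \<longrightarrow> 0 < T \<longrightarrow> T < D \<longrightarrow> cut_value D c x \<le> cut_value D (P, Q, T) x"
      "cut_value D c x < cut_value D c' x"
      using support[OF c(1)] c by blast
    then show ?thesis unfolding supports_def by (cases c; cases c') blast
  qed
  \<comment> \<open>The triples \<open>2q - q'\<close> and, if \<open>T' < T\<close>,
    \<open>q - q'\<close> are admissible members of \<open>L\<close>, so the supporting point of
    \<open>q\<close> may be compared with them.\<close>
  have nomixed: False
    if q: "(P, Q, T) \<in> L" "(P', Q', T') \<in> L" "0 < T" "T < D" "0 < T'" "T' < D"
      and near: "near T T'" "near (D - T) (D - T')" "near P P'" "near Q Q'"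
      and sign: "0 \<le> P" "0 \<le> P'" "Q \<le> 0" "Q' \<le> 0"
      and sup: "supports (P, Q, T) (P', Q', T')" "supports (P', Q', T') (P, Q, T)"
      and le: "T' \<le> T" for P Q T P' Q' T'
  proof -
    obtain s where s: "s \<in> X" "cut_value D (P, Q, T) s < cut_value D (P', Q', T') s"
      "\<And>A B U. (A, B, U) \<in> L \<Longrightarrow> 0 < U \<Longrightarrow> U < D \<Longrightarrow> cut_value D (P, Q, T) s \<le> cut_value D (A, B, U) s"
      using sup(1) unfolding supports_def by auto
    obtain r where r: "r \<in> X" "cut_value D (P', Q', T') r < cut_value D (P, Q, T) r"
      using sup(2) unfolding supports_def by auto
    have "0 < 2 * T - T'" "2 * T - T' < D" using near(1,2) q unfolding near_def by auto
    then have 1: "cut_value D (P, Q, T) s \<le> cut_value D (2 * P - P', 2 * Q - Q', 2 * T - T') s"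
      by (intro s(3) refl[OF q(1,2)])
    have "(P - P', Q - Q', T - T') \<in> L" using L(1)[OF q(1,2)] by simp
    then have 2: "cut_value D (P, Q, T) s \<le> cut_value D (P - P', Q - Q', T - T') s" if "T' < T"
      using that q by (intro s(3)) auto
    have X: "0 \<le> fst s" "0 \<le> snd s" "0 \<le> fst r" "0 \<le> snd r" using s(1) r(1) by (auto simp: X_def)
    show False
      by (rule mixed_cuts_not_both_supporting[OF q(3-6) le near sign X(1,2) s(2) X(3,4) r(2) 1 2])
  qed
  \<comment> \<open>Nearness gives \<open>P'\<close> and \<open>Q'\<close> the signs of
    \<open>P\<close> and \<open>Q\<close>. Either the same-sign argument applies, or the mixed one
    after ordering the two triples by \<open>T\<close>.\<close>
  have nononneg: False
    if q: "(P, Q, T) \<in> L" "(P', Q', T') \<in> L" "0 < T" "T < D" "0 < T'" "T' < D"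
      and near: "near T T'" "near (D - T) (D - T')" "near P P'" "near Q Q'"
      and sign: "0 \<le> P"
      and sup: "supports (P, Q, T) (P', Q', T')" "supports (P', Q', T') (P, Q, T)"
    for P Q T P' Q' T'
  proof -
    have P': "0 \<le> P'" "0 \<le> 2 * P - P'" using near(3) sign unfolding near_def by auto
    show False
    proof (cases "0 \<le> Q")
      case True
      then have Q': "0 \<le> Q'" "0 \<le> 2 * Q - Q'" using near(4) unfolding near_def by auto
      have T': "2 * T - T' < D" "0 < 2 * T - T'" using near(1,2) q unfolding near_def by auto
      obtain s where s: "cut_value D (P, Q, T) s < cut_value D (P', Q', T') s"
        "\<And>A B U. (A, B, U) \<in> L \<Longrightarrow> 0 < U \<Longrightarrow> U < D \<Longrightarrow> cut_value D (P, Q, T) s \<le> cut_value D (A, B, U) s"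
        using sup(1) unfolding supports_def by auto
      show False
        using reflected_cut_same_sign[OF q(3-6) T' sign P' True Q' s(1)] s(2)[OF refl[OF q(1,2)] T'(2,1)]
        by linarith
    next
      case False
      then have Q: "Q \<le> 0" "Q' \<le> 0" using near(4) unfolding near_def by auto
      show False
      proof (cases "T' \<le> T")
        case True
        then show False using nomixed[OF q near sign P'(1) Q sup] by blast
      next
        case F: False
        then show False
          using nomixed[OF q(2,1,5,6,3,4) near[THEN near_sym] P'(1) sign Q(2,1) sup(2,1)] by linarith
      qed
    qed
  qed
  \<comment> \<open>The code records sign and bit length of exactly the four numbers whose nearness
    the collision argument requires.\<close>
  define \<beta> where "\<beta> = (\<lambda>(P, Q, T). (sgn P * bitlen \<bar>P\<bar>, sgn Q * bitlen \<bar>Q\<bar>, sgn T * bitlen \<bar>T\<bar>,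
    sgn (D - T) * bitlen \<bar>D - T\<bar>))"
  have "inj_on \<beta> S"
  proof (rule inj_onI, rule ccontr)
    fix q q' assume qS: "q \<in> S" "q' \<in> S" and eq: "\<beta> q = \<beta> q'" and ne: "q \<noteq> q'"
    obtain P Q T P' Q' T' where q: "q = (P, Q, T)" "q' = (P', Q', T')" by (metis prod_cases3)
    have near: "near T T'" "near (D - T) (D - T')" "near P P'" "near Q Q'"
      using eq by (auto simp: q \<beta>_def intro: near_if_signed_bitlen_eq)
    have F: "(P, Q, T) \<in> L" "(P', Q', T') \<in> L" "0 < T" "T < D" "0 < T'" "T' < D"
      using qS S(1) by (auto simp: q F_def)
    have sup: "supports (P, Q, T) (P', Q', T')" "supports (P', Q', T') (P, Q, T)"
      using supp[OF qS(1,2)] supp[OF qS(2,1)] ne unfolding q by auto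
    show False
    proof (cases "0 \<le> P")
      case True
      show False using nononneg[OF F near True sup] .
    next
      case False
      \<comment> \<open>Here \<open>P < 0\<close>: pass to the opposite split, which has the same
        cut values and exchanges \<open>T\<close> with \<open>D - T\<close>.\<close>
      have cv: "cut_value D (- A, - B, D - U) x = cut_value D (A, B, U) x" for A B U x
        by (simp add: cut_value_def cut_coeff_minus)
      have sup': "supports (- P, - Q, D - T) (- P', - Q', D - T')"
        "supports (- P', - Q', D - T') (- P, - Q, D - T)"
        using sup unfolding supports_def by (simp_all add: cv)
      show False
        by (rule nononneg[OF neg[OF F(1)] neg[OF F(2)] _ _ _ _ _ _ _ _ _ sup'])
          (use near False F(3-6) in \<open>simp_all add: near_minus\<close>)
    qed
  qed
  moreover have "\<beta> ` S \<subseteq> {- bitlen D..bitlen D} \<times> {- bitlen D..bitlen D} \<times> {- bitlen D..bitlen D} \<times> {- bitlen D..bitlen D}"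
  proof -
    \<comment> \<open>All four numbers are smaller than \<open>D\<close> in absolute value, so each
      code coordinate takes at most \<open>2 * bitlen D + 1\<close> values.\<close>
    have b: "- bitlen D \<le> sgn z * bitlen \<bar>z\<bar> \<and> sgn z * bitlen \<bar>z\<bar> \<le> bitlen D" if "\<bar>z\<bar> < D" for z
    proof -
      have "bitlen \<bar>z\<bar> \<le> bitlen D" using that unfolding bitlen_def
        by (simp add: floorlog_mono)
      then show ?thesis using bitlen_nonneg[of "\<bar>z\<bar>"] by (auto simp: sgn_if)
    qed
    show ?thesis
    proof (rule image_subsetI)
      fix q assume "q \<in> S"
      moreover obtain P Q T where q: "q = (P, Q, T)" by (metis prod_cases3)
      ultimately have "\<bar>P\<bar> < D" "\<bar>Q\<bar> < D" "\<bar>T\<bar> < D" "\<bar>D - T\<bar> < D" using S(1) by (auto simp: F_def)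
      from this[THEN b] show "\<beta> q \<in> {- bitlen D..bitlen D} \<times> {- bitlen D..bitlen D} \<times> {- bitlen D..bitlen D} \<times> {- bitlen D..bitlen D}"
        by (simp add: \<beta>_def q)
    qed
  qed
  ultimately have "card S \<le> card ({- bitlen D..bitlen D} \<times> {- bitlen D..bitlen D} \<times> {- bitlen D..bitlen D} \<times> {- bitlen D..bitlen D})"
    by (metis card_image card_mono finite_atLeastAtMost_int finite_cartesian_product)
  also have "\<dots> = (nat (2 * bitlen D + 1)) ^ 4"
    by (simp add: card_cartesian_product eval_nat_numeral)
  also have "nat (2 * bitlen D + 1) = 2 * nat (bitlen D) + 1"
    using bitlen_nonneg[of D] by (simp add: nat_add_distrib nat_mult_distrib)
  finally have card: "card S \<le> (2 * nat (bitlen D) + 1) ^ 4" .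
  show ?thesis
  proof (rule that[OF _ card])
    show "finite S" using S(1) \<open>finite F\<close> finite_subset by blast
    show "(P, Q, T) \<in> L \<and> \<bar>P\<bar> < D \<and> \<bar>Q\<bar> < D \<and> 0 < T \<and> T < D" if "(P, Q, T) \<in> S" for P Q T
      using that S(1) by (auto simp: F_def)
    show "\<exists>c\<in>S. cut_value D c s \<le> cut_value D (P, Q, T) s"
      if h: "(P, Q, T) \<in> L" "0 < T" "T < D" "0 \<le> fst s" "0 \<le> snd s" for P Q T s
    proof -
      have s: "s \<in> X" using h by (simp add: X_def)
      obtain g where g: "g \<in> F" "cut_value D g s \<le> cut_value D (P, Q, T) s"
        using red[OF h(1-3)] s by blast
      then show ?thesis using S(2)[OF g(1) s] by (meson order_trans)
    qed
  qed
qed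

subsection \<open>Reduction to half-planes and cones\<close>

definition det2 :: "int^2 \<Rightarrow> int^2 \<Rightarrow> int" where
  "det2 a b = a $ 1 * b $ 2 - a $ 2 * b $ 1"

definition halfplane :: "int^2 \<Rightarrow> int \<Rightarrow> (real^2) set" where
  "halfplane a \<beta> = {x. real_vec a \<bullet> x \<le> real_of_int \<beta>}"

lemma real_vec_nth [simp]: "real_vec a $ i = real_of_int (a $ i)"
  by (simp add: real_vec_def)

lemma real_vec_inner: "real_vec a \<bullet> x = real_of_int (a $ 1) * x $ 1 + real_of_int (a $ 2) * x $ 2"
  by (simp add: real_vec_def inner_vec_def sum_2)

lemma int_vec2_eq_0_iff: "a = 0 \<longleftrightarrow> a $ 1 = 0 \<and> a $ 2 = 0" for a :: "int^2"
  by (simp add: vec_eq_iff forall_2)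

lemma convex_halfplane: "convex (halfplane a \<beta>)"
  unfolding halfplane_def by (rule convex_halfspace_le)

section \<open>Split hulls and lines through a point of the strip\<close>

lemma split_hull_subset: "convex P \<Longrightarrow> split_hull P \<pi> \<pi>0 \<subseteq> P"
  unfolding split_hull_def by (intro hull_minimal) auto

lemma split_hull_mono: "P \<subseteq> P' \<Longrightarrow> split_hull P \<pi> \<pi>0 \<subseteq> split_hull P' \<pi> \<pi>0"
  unfolding split_hull_def by (intro hull_mono) auto

lemma split_closure_mono: "P \<subseteq> P' \<Longrightarrow> split_closure P \<subseteq> split_closure P'"
  unfolding split_closure_def by (intro INF_mono' split_hull_mono)

lemma split_closure_subset:
  assumes "convex P"
  shows "split_closure P \<subseteq> P"
proof -
  have "split_closure P \<subseteq> split_hull P 1 0" unfolding split_closure_def by (auto simp: vec_eq_iff)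
  then show ?thesis using split_hull_subset[OF assms] by blast
qed

lemma in_split_hull_outside_strip:
  assumes "x \<in> P" "\<not> (real_of_int \<pi>0 < real_vec \<pi> \<bullet> x \<and> real_vec \<pi> \<bullet> x < real_of_int (\<pi>0 + 1))"
  shows "x \<in> split_hull P \<pi> \<pi>0"
  unfolding split_hull_def using assms by (intro hull_inc) auto

text \<open>A segment joining the two sides crosses the whole strip; trim it at the two boundaries
  and scale its direction. Conversely the two boundary points combine to \<open>x\<close> with
  weights \<open>1 - \<mu>\<close> and \<open>\<mu>\<close>. A hull is thereby traded for the choice
  of one direction, to which Helly's theorem applies.\<close>

lemma in_split_hull_strip_iff:
  assumes P: "convex P" and strip: "real_of_int \<pi>0 < real_vec \<pi> \<bullet> x" "real_vec \<pi> \<bullet> x < real_of_int (\<pi>0 + 1)"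
  defines "\<mu> \<equiv> real_vec \<pi> \<bullet> x - real_of_int \<pi>0"
  shows "x \<in> split_hull P \<pi> \<pi>0 \<longleftrightarrow>
    (\<exists>d. real_vec \<pi> \<bullet> d = 1 \<and> x - \<mu> *\<^sub>R d \<in> P \<and> x + (1 - \<mu>) *\<^sub>R d \<in> P)"
proof
  have mu: "0 < \<mu>" "\<mu> < 1" using strip by (auto simp: \<mu>_def)
  define S where "S = P \<inter> {x. real_vec \<pi> \<bullet> x \<le> real_of_int \<pi>0}"
  define T where "T = P \<inter> {x. real_vec \<pi> \<bullet> x \<ge> real_of_int (\<pi>0 + 1)}"
  have hull: "split_hull P \<pi> \<pi>0 = convex hull (S \<union> T)" by (simp add: split_hull_def S_def T_def)
  have conv: "convex S" "convex T"
    unfolding S_def T_def using P by (auto intro!: convex_Int convex_halfspace_le convex_halfspace_ge)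
  show "\<exists>d. real_vec \<pi> \<bullet> d = 1 \<and> x - \<mu> *\<^sub>R d \<in> P \<and> x + (1 - \<mu>) *\<^sub>R d \<in> P"
    if x: "x \<in> split_hull P \<pi> \<pi>0"
  proof -
    have notST: "x \<notin> S" "x \<notin> T" using strip by (auto simp: S_def T_def)
    \<comment> \<open>With one side empty the hull would be the other side, which does not contain
      \<open>x\<close>.\<close>
    have ne: "S \<noteq> {}" "T \<noteq> {}" using x notST conv unfolding hull by (auto simp: hull_same)
    obtain u v y z where uv: "0 \<le> u" "0 \<le> v" "u + v = 1" "y \<in> S" "z \<in> T" "x = u *\<^sub>R y + v *\<^sub>R z"
      using x unfolding hull convex_hull_union_two[OF conv(1) ne(1) conv(2) ne(2)] by blast
    have yz: "y \<in> P" "z \<in> P" "real_vec \<pi> \<bullet> y \<le> real_of_int \<pi>0" "real_of_int \<pi>0 + 1 \<le> real_vec \<pi> \<bullet> z"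
      using uv by (auto simp: S_def T_def)
    define w where "w = real_vec \<pi> \<bullet> (z - y)"
    have w: "1 \<le> w" using yz by (simp add: w_def inner_diff_right)
    have u: "u = 1 - v" using uv by simp
    have x: "x = y + v *\<^sub>R (z - y)" using uv(6) by (simp add: u algebra_simps)
    have px: "real_vec \<pi> \<bullet> x = real_vec \<pi> \<bullet> y + v * w"
      unfolding w_def x by (simp add: inner_add_right)
    have pz: "real_vec \<pi> \<bullet> z = real_vec \<pi> \<bullet> y + w" by (simp add: w_def inner_diff_right)
    have seg: "y + t *\<^sub>R (z - y) \<in> P" if "0 \<le> t" "t \<le> 1" for t
      using convexD_alt[OF P yz(1,2) that] by (simp add: algebra_simps)
    \<comment> \<open>In units of \<open>z - y\<close>, the left boundary is
      \<open>\<mu> / w\<close> behind \<open>x\<close> and the right one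
      \<open>(1 - \<mu>) / w\<close> ahead; these inequalities keep both crossing points between
      \<open>y\<close> and \<open>z\<close>.\<close>
    have "\<mu> \<le> v * w" "1 - \<mu> \<le> (1 - v) * w" using px pz yz by (auto simp: \<mu>_def algebra_simps)
    then have 1: "\<mu> / w \<le> v" "(1 - \<mu>) / w \<le> 1 - v" using w by (auto simp: divide_le_eq)
    have 2: "0 \<le> \<mu> / w" "0 \<le> (1 - \<mu>) / w" using w mu by auto
    define d where "d = (1 / w) *\<^sub>R (z - y)"
    have "real_vec \<pi> \<bullet> d = 1" using w by (simp add: d_def w_def[symmetric])
    moreover have "x - \<mu> *\<^sub>R d \<in> P"
      using seg[of "v - \<mu> / w"] 1 2 uv(1) u by (simp add: x d_def algebra_simps)
    moreover have "x + (1 - \<mu>) *\<^sub>R d \<in> P"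
    proof -
      have "x + (1 - \<mu>) *\<^sub>R d = y + (v + (1 - \<mu>) / w) *\<^sub>R (z - y)"
        by (simp only: x d_def scaleR_add_left scaleR_scaleR times_divide_eq_right mult_1_right add.assoc)
      then show ?thesis using seg[of "v + (1 - \<mu>) / w"] 1 2 uv(2) by simp
    qed
    ultimately show ?thesis by blast
  qed
  show "x \<in> split_hull P \<pi> \<pi>0"
    if ex: "\<exists>d. real_vec \<pi> \<bullet> d = 1 \<and> x - \<mu> *\<^sub>R d \<in> P \<and> x + (1 - \<mu>) *\<^sub>R d \<in> P"
  proof -
    obtain d where d: "real_vec \<pi> \<bullet> d = 1" "x - \<mu> *\<^sub>R d \<in> P" "x + (1 - \<mu>) *\<^sub>R d \<in> P" using ex by blast
    have "x - \<mu> *\<^sub>R d \<in> S \<union> T" "x + (1 - \<mu>) *\<^sub>R d \<in> S \<union> T"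
      using d by (auto simp: S_def T_def \<mu>_def inner_diff_right inner_add_right)
    then have m: "x - \<mu> *\<^sub>R d \<in> convex hull (S \<union> T)" "x + (1 - \<mu>) *\<^sub>R d \<in> convex hull (S \<union> T)"
      by (auto intro: hull_inc)
    have "(1 - \<mu>) *\<^sub>R (x - \<mu> *\<^sub>R d) + \<mu> *\<^sub>R (x + (1 - \<mu>) *\<^sub>R d) \<in> convex hull (S \<union> T)"
      using mu by (intro convexD[OF convex_convex_hull m]) auto
    moreover have "(1 - \<mu>) *\<^sub>R (x - \<mu> *\<^sub>R d) + \<mu> *\<^sub>R (x + (1 - \<mu>) *\<^sub>R d) = x"
      by (simp add: algebra_simps)
    ultimately show ?thesis by (simp add: hull)
  qed
qed

lemma parallel_inner_zero:
  assumes "det2 a a' = 0" "a \<noteq> 0" "real_vec a \<bullet> d = 0"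
  shows "real_vec a' \<bullet> d = 0"
proof -
  have e: "real_of_int (a $ 1) * real_of_int (a' $ 2) = real_of_int (a $ 2) * real_of_int (a' $ 1)"
    using assms(1) unfolding det2_def of_int_mult[symmetric] of_int_eq_iff by simp
  have z: "real_of_int (a $ 1) * d $ 1 + real_of_int (a $ 2) * d $ 2 = 0"
    using assms(3) by (simp add: real_vec_inner)
  have "real_of_int (a $ 1) * (real_vec a' \<bullet> d) = 0" "real_of_int (a $ 2) * (real_vec a' \<bullet> d) = 0"
  proof -
    have "real_of_int (a $ 1) * (real_vec a' \<bullet> d)
        = real_of_int (a' $ 1) * (real_of_int (a $ 1) * d $ 1 + real_of_int (a $ 2) * d $ 2)"
      using e by (simp add: real_vec_inner algebra_simps)
    then show "real_of_int (a $ 1) * (real_vec a' \<bullet> d) = 0" by (simp add: z)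
    have "real_of_int (a $ 2) * (real_vec a' \<bullet> d)
        = real_of_int (a' $ 2) * (real_of_int (a $ 1) * d $ 1 + real_of_int (a $ 2) * d $ 2)"
      using e by (simp add: real_vec_inner algebra_simps)
    then show "real_of_int (a $ 2) * (real_vec a' \<bullet> d) = 0" by (simp add: z)
  qed
  then show ?thesis using assms(2) by (auto simp: int_vec2_eq_0_iff)
qed

text \<open>Helly's theorem in dimension one, with families of fewer than two sets treated
  separately. The case \<open>X = Y\<close> of the hypothesis makes each single set
  nonempty.\<close>

lemma Helly_real:
  fixes F :: "real set set"
  assumes "finite F" "\<And>X. X \<in> F \<Longrightarrow> convex X" "\<And>X Y. X \<in> F \<Longrightarrow> Y \<in> F \<Longrightarrow> X \<inter> Y \<noteq> {}"
  shows "\<Inter>F \<noteq> {}"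
proof (cases "card F \<ge> 2")
  case True
  show ?thesis
  proof (rule Helly)
    show "\<Inter>t \<noteq> {}" if t: "t \<subseteq> F" "card t = DIM(real) + 1" for t
    proof -
      obtain X Y where "t = {X, Y}" using t(2) card_2_iff[of t] by (auto simp: numeral_2_eq_2)
      then show ?thesis using t(1) assms(3)[of X Y] by auto
    qed
  qed (use assms True in auto)
next
  case False
  then have "card F = 0 \<or> card F = 1" by linarith
  then show ?thesis using assms(1,3) by (auto simp: card_1_singleton_iff)
qed

text \<open>
  Parallel pairs need no assumption: either their common direction is an admissible line for both,
  or they are parallel to the strip and the choice of the line does not matter.
\<close>

lemma in_split_hull_halfplanes:
  fixes a :: "'i \<Rightarrow> int^2"
  assumes I: "finite I" and \<pi>: "\<pi> \<noteq> 0"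
    and single: "\<And>i. i \<in> I \<Longrightarrow> x \<in> split_hull (halfplane (a i) (\<beta> i)) \<pi> \<pi>0"
    and pair: "\<And>i j. i \<in> I \<Longrightarrow> j \<in> I \<Longrightarrow> 0 < det2 (a i) (a j) \<Longrightarrow>
      x \<in> split_hull (halfplane (a i) (\<beta> i) \<inter> halfplane (a j) (\<beta> j)) \<pi> \<pi>0"
  shows "x \<in> split_hull (\<Inter>i\<in>I. halfplane (a i) (\<beta> i)) \<pi> \<pi>0"
proof (cases "real_of_int \<pi>0 < real_vec \<pi> \<bullet> x \<and> real_vec \<pi> \<bullet> x < real_of_int (\<pi>0 + 1)")
  have xI: "x \<in> halfplane (a i) (\<beta> i)" if "i \<in> I" for i
    using single[OF that] split_hull_subset[OF convex_halfplane] by blast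
  case False
  then show ?thesis using xI by (intro in_split_hull_outside_strip) auto
next
  have xI: "x \<in> halfplane (a i) (\<beta> i)" if "i \<in> I" for i
    using single[OF that] split_hull_subset[OF convex_halfplane] by blast
  case True
  define \<mu> where "\<mu> = real_vec \<pi> \<bullet> x - real_of_int \<pi>0"
  have iff: "x \<in> split_hull P \<pi> \<pi>0 \<longleftrightarrow>
    (\<exists>d. real_vec \<pi> \<bullet> d = 1 \<and> x - \<mu> *\<^sub>R d \<in> P \<and> x + (1 - \<mu>) *\<^sub>R d \<in> P)" if "convex P" for P
    using in_split_hull_strip_iff[OF that] True by (simp add: \<mu>_def)
  define n where "n = real_vec \<pi> \<bullet> real_vec \<pi>"
  have n: "0 < n" using \<pi> by (auto simp: n_def int_vec2_eq_0_iff real_vec_def vec_eq_iff forall_2)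
  \<comment> \<open>\<open>e\<close> is orthogonal to the normal, so \<open>dir l\<close> runs
    through all directions \<open>d\<close> with
    \<open>real_vec \<pi> \<bullet> d = 1\<close>.\<close>
  define e :: "real^2" where "e = vector [- real_of_int (\<pi> $ 2), real_of_int (\<pi> $ 1)]"
  define dir where "dir l = (1 / n) *\<^sub>R real_vec \<pi> + l *\<^sub>R e" for l
  have pe: "real_vec \<pi> \<bullet> e = 0" by (simp add: real_vec_inner e_def)
  have pdir: "real_vec \<pi> \<bullet> dir l = 1" for l
    using n pe by (simp add: dir_def inner_add_right n_def)
  have dir: "\<exists>l. d = dir l" if d: "real_vec \<pi> \<bullet> d = 1" for d
  proof -
    define p1 p2 where p: "p1 = real_of_int (\<pi> $ 1)" "p2 = real_of_int (\<pi> $ 2)"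
    have n': "n = p1 * p1 + p2 * p2" by (simp add: n_def real_vec_inner p)
    have d': "p1 * d $ 1 + p2 * d $ 2 = 1" using d by (simp add: real_vec_inner p)
    define l where "l = (p1 * d $ 2 - p2 * d $ 1) / n"
    have "n * d $ 1 = p1 * (p1 * d $ 1 + p2 * d $ 2) - (p1 * d $ 2 - p2 * d $ 1) * p2"
      "n * d $ 2 = p2 * (p1 * d $ 1 + p2 * d $ 2) + (p1 * d $ 2 - p2 * d $ 1) * p1"
      unfolding n' by (simp_all add: algebra_simps)
    then have "n * d $ 1 = p1 - (p1 * d $ 2 - p2 * d $ 1) * p2" "n * d $ 2 = p2 + (p1 * d $ 2 - p2 * d $ 1) * p1"
      unfolding d' by simp_all
    then have "d $ 1 = p1 / n - l * p2" "d $ 2 = p2 / n + l * p1"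
      using n by (auto simp: l_def field_simps)
    then have "d = dir l" by (simp add: vec_eq_iff forall_2 dir_def e_def real_vec_def p)
    then show ?thesis by blast
  qed
  have hit: "\<exists>l. x - \<mu> *\<^sub>R dir l \<in> P \<and> x + (1 - \<mu>) *\<^sub>R dir l \<in> P"
    if h: "convex P" "x \<in> split_hull P \<pi> \<pi>0" for P
  proof -
    obtain d where d: "real_vec \<pi> \<bullet> d = 1" "x - \<mu> *\<^sub>R d \<in> P" "x + (1 - \<mu>) *\<^sub>R d \<in> P"
      using h(2) iff[OF h(1)] by auto
    then show ?thesis using dir[OF d(1)] by auto
  qed
  \<comment> \<open>The parameters of the lines admissible for inequality \<open>i\<close>. Each
    such set is convex in \<open>l\<close>, and \<open>x\<close> lies in the split hull as soon as
    all of them have a common point.\<close>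
  define good where "good i = {l. x - \<mu> *\<^sub>R dir l \<in> halfplane (a i) (\<beta> i)
    \<and> x + (1 - \<mu>) *\<^sub>R dir l \<in> halfplane (a i) (\<beta> i)}" for i
  have good_eq: "good i = {l. (- \<mu> * (real_vec (a i) \<bullet> e)) \<bullet> l \<le>
        real_of_int (\<beta> i) - real_vec (a i) \<bullet> x + \<mu> * (real_vec (a i) \<bullet> dir 0)} \<inter>
      {l. ((1 - \<mu>) * (real_vec (a i) \<bullet> e)) \<bullet> l \<le>
        real_of_int (\<beta> i) - real_vec (a i) \<bullet> x - (1 - \<mu>) * (real_vec (a i) \<bullet> dir 0)}" for i
    unfolding good_def halfplane_def dir_def by (auto simp: inner_diff_right inner_add_right algebra_simps)
  have conv: "convex (good i)" for i
    unfolding good_eq by (intro convex_Int convex_halfspace_le)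
  have ne: "good i \<noteq> {}" if "i \<in> I" for i
    using hit[OF convex_halfplane single[OF that]] by (auto simp: good_def)
  have pos: "good i \<inter> good j \<noteq> {}" if ij: "i \<in> I" "j \<in> I" "0 < det2 (a i) (a j)" for i j
    using hit[OF convex_Int[OF convex_halfplane convex_halfplane] pair[OF ij]] by (auto simp: good_def)
  have par: "good i \<inter> good j \<noteq> {}"
    if ij: "i \<in> I" "j \<in> I" "det2 (a i) (a j) = 0" "real_vec (a i) \<bullet> e \<noteq> 0" for i j
  proof -
    \<comment> \<open>This \<open>l\<close> makes \<open>dir l\<close> parallel to both boundary
      lines, so both end points have the same slacks as \<open>x\<close>.\<close>
    define l where "l = - (real_vec (a i) \<bullet> dir 0) / (real_vec (a i) \<bullet> e)"
    have "real_vec (a i) \<bullet> dir l = real_vec (a i) \<bullet> dir 0 + l * (real_vec (a i) \<bullet> e)"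
      by (simp add: dir_def inner_add_right)
    then have "real_vec (a i) \<bullet> dir l = 0" using ij(4) by (simp add: l_def)
    moreover have "a i \<noteq> 0" using ij(4) by (auto simp: real_vec_inner)
    ultimately have "real_vec (a i) \<bullet> dir l = 0" "real_vec (a j) \<bullet> dir l = 0"
      using parallel_inner_zero[OF ij(3)] by auto
    then have "l \<in> good i" "l \<in> good j"
      using xI[OF ij(1)] xI[OF ij(2)] by (auto simp: good_def halfplane_def inner_diff_right inner_add_right)
    then show ?thesis by blast
  qed
  have meet: "good i \<inter> good j \<noteq> {}" if ij: "i \<in> I" "j \<in> I" for i j
  proof -
    have swap: "det2 (a j) (a i) = - det2 (a i) (a j)" by (simp add: det2_def)
    consider "0 < det2 (a i) (a j)" | "0 < det2 (a j) (a i)"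
      | "det2 (a i) (a j) = 0" "real_vec (a i) \<bullet> e \<noteq> 0" | "det2 (a j) (a i) = 0" "real_vec (a j) \<bullet> e \<noteq> 0"
      | "real_vec (a i) \<bullet> e = 0" "real_vec (a j) \<bullet> e = 0"
      using swap by linarith
    then show ?thesis
    proof cases
      case 1
      then show ?thesis using pos[OF ij] by simp
    next
      case 2
      then show ?thesis using pos[OF ij(2,1)] by (simp add: Int_commute)
    next
      case 3
      then show ?thesis using par[OF ij] by simp
    next
      case 4
      then show ?thesis using par[OF ij(2,1)] by (simp add: Int_commute)
    next
      case 5
      \<comment> \<open>Both normals are orthogonal to \<open>e\<close>, so neither condition
        depends on \<open>l\<close>.\<close>
      obtain l0 where "l0 \<in> good i" using ne[OF ij(1)] by blast
      then have "l \<in> good i" for l using 5(1) unfolding good_eq Int_iff mem_Collect_eq by simp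
      then show ?thesis using ne[OF ij(2)] by auto
    qed
  qed
  have "\<Inter>(good ` I) \<noteq> {}" using I conv meet by (intro Helly_real) auto
  then obtain l where "\<And>i. i \<in> I \<Longrightarrow> l \<in> good i" by auto
  then have "x - \<mu> *\<^sub>R dir l \<in> (\<Inter>i\<in>I. halfplane (a i) (\<beta> i)) \<and>
    x + (1 - \<mu>) *\<^sub>R dir l \<in> (\<Inter>i\<in>I. halfplane (a i) (\<beta> i))"
    by (auto simp: good_def)
  moreover have "convex (\<Inter>i\<in>I. halfplane (a i) (\<beta> i))"
    by (intro convex_INT convex_halfplane)
  ultimately show ?thesis
    by (subst iff) (auto intro!: exI[of _ "dir l"] simp: pdir)
qed

text \<open>The pairwise criterion holds for each split separately and hence for the intersection
  over all splits. Positive determinant selects one order of every nonparallel pair.\<close>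

lemma split_closure_halfplanes:
  fixes a :: "'i \<Rightarrow> int^2"
  assumes I: "finite I"
  shows "split_closure (\<Inter>i\<in>I. halfplane (a i) (\<beta> i)) =
    (\<Inter>i\<in>I. split_closure (halfplane (a i) (\<beta> i))) \<inter>
    (\<Inter>(i, j)\<in>{(i, j). i \<in> I \<and> j \<in> I \<and> 0 < det2 (a i) (a j)}.
      split_closure (halfplane (a i) (\<beta> i) \<inter> halfplane (a j) (\<beta> j)))" (is "?L = ?R")
proof
  have "?L \<subseteq> split_closure (halfplane (a i) (\<beta> i))" if "i \<in> I" for i
    using that by (intro split_closure_mono) auto
  moreover have "?L \<subseteq> split_closure (halfplane (a i) (\<beta> i) \<inter> halfplane (a j) (\<beta> j))"
    if "i \<in> I" "j \<in> I" for i j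
    using that by (intro split_closure_mono) auto
  ultimately show "?L \<subseteq> ?R" by blast
  show "?R \<subseteq> ?L"
  proof
    fix x assume "x \<in> ?R"
    then have "x \<in> split_hull (\<Inter>i\<in>I. halfplane (a i) (\<beta> i)) \<pi> \<pi>0" if "\<pi> \<noteq> 0" for \<pi> \<pi>0
      using that by (intro in_split_hull_halfplanes[OF I]) (auto simp: split_closure_def)
    then show "x \<in> ?L" by (auto simp: split_closure_def)
  qed
qed

subsection \<open>The split closure of a half-plane\<close>

lemma abs_div_le_abs:
  fixes b g :: int
  assumes "0 < g"
  shows "\<bar>b div g\<bar> \<le> \<bar>b\<bar>"
proof (cases "0 \<le> b")
  case True
  then show ?thesis using assms by (simp add: pos_imp_zdiv_nonneg_iff int_div_less_self zdiv_mono2[of b 1 g, simplified])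
next
  case False
  have "b \<le> b div g"
  proof -
    have "g * b \<le> b" using assms False mult_right_mono_neg[of 1 g b] by simp
    then have "(g * b) div g \<le> b div g" using assms by (intro zdiv_mono1) auto
    then show ?thesis using assms by simp
  qed
  then show ?thesis using False assms pos_imp_zdiv_neg_iff[of g b] by simp
qed

text \<open>The result is the Chvatal-Gomory rounding: divide by the gcd of the coefficients and
  round the right-hand side down. The split along the primitive normal enforces it. No split removes
  more: a nonparallel one can be crossed along the boundary direction, and for a parallel one the
  integrality of \<open>\<beta>'\<close> leaves room for the strip.\<close>

lemma split_closure_halfplane:
  obtains a' \<beta>' where "split_closure (halfplane a \<beta>) = halfplane a' \<beta>'"
    "\<And>j. \<bar>a' $ j\<bar> \<le> \<bar>a $ j\<bar>" "\<bar>\<beta>'\<bar> \<le> \<bar>\<beta>\<bar>"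
proof (cases "a = 0")
  case True
  \<comment> \<open>For \<open>a = 0\<close> the half-plane is empty or the whole plane, and a split
    hull of the plane is the plane.\<close>
  have key: "x \<in> split_hull (halfplane a \<beta>) \<pi> \<pi>0" if x: "x \<in> halfplane a \<beta>" "\<pi> \<noteq> 0" for x \<pi> \<pi>0
  proof -
    have U: "halfplane a \<beta> = UNIV" using x(1) by (auto simp: halfplane_def True real_vec_inner split: if_splits)
    define n where "n = real_vec \<pi> \<bullet> real_vec \<pi>"
    have "n \<noteq> 0" using x(2) by (auto simp: n_def int_vec2_eq_0_iff vec_eq_iff forall_2)
    then have "real_vec \<pi> \<bullet> ((1 / n) *\<^sub>R real_vec \<pi>) = 1" by (simp add: n_def)
    then have "\<exists>d. real_vec \<pi> \<bullet> d = 1" by blast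
    then show ?thesis unfolding U
      using in_split_hull_strip_iff[OF convex_UNIV, of \<pi>0 \<pi> x] in_split_hull_outside_strip[of x UNIV \<pi>0 \<pi>]
      by auto
  qed
  have "halfplane a \<beta> \<subseteq> split_closure (halfplane a \<beta>)"
    using key by (auto simp: split_closure_def)
  then have "split_closure (halfplane a \<beta>) = halfplane a \<beta>"
    using split_closure_subset[OF convex_halfplane] by (rule subset_antisym[rotated])
  then show ?thesis using that by blast
next
  case False
  define g where "g = gcd (a $ 1) (a $ 2)"
  have g: "0 < g" using False by (simp add: g_def int_vec2_eq_0_iff)
  define a' :: "int^2" where "a' = (\<chi> j. a $ j div g)"
  define \<beta>' where "\<beta>' = \<beta> div g"
  have ag: "a $ 1 = g * a' $ 1" "a $ 2 = g * a' $ 2" by (simp_all add: a'_def g_def)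
  have ax: "real_vec a \<bullet> x = real_of_int g * (real_vec a' \<bullet> x)" for x
    by (simp add: real_vec_inner ag algebra_simps)
  have "coprime (a' $ 1) (a' $ 2)" unfolding a'_def g_def using False
    by (simp add: div_gcd_coprime int_vec2_eq_0_iff)
  then obtain u v where uv: "u * a' $ 1 + v * a' $ 2 = 1"
    using bezout_int[of "a' $ 1" "a' $ 2"] by (auto simp: coprime_iff_gcd_eq_1)
  have a'0: "a' \<noteq> 0" using uv by (auto simp: int_vec2_eq_0_iff)
  have floor: "real_of_int g * real_of_int \<beta>' \<le> real_of_int \<beta>" "real_of_int \<beta> < real_of_int g * (real_of_int \<beta>' + 1)"
  proof -
    have "g * (\<beta> div g) + \<beta> mod g = \<beta>" by (rule mult_div_mod_eq)
    then have "g * \<beta>' \<le> \<beta>" "\<beta> < g * (\<beta>' + 1)"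
      using pos_mod_bound[OF g, of \<beta>] pos_mod_sign[OF g, of \<beta>] unfolding \<beta>'_def distrib_left
      by linarith+
    then have "real_of_int (g * \<beta>') \<le> real_of_int \<beta>" "real_of_int \<beta> < real_of_int (g * (\<beta>' + 1))"
      by (simp_all only: of_int_le_iff of_int_less_iff)
    then show "real_of_int g * real_of_int \<beta>' \<le> real_of_int \<beta>" "real_of_int \<beta> < real_of_int g * (real_of_int \<beta>' + 1)"
      by simp_all
  qed
  have sub: "x \<in> halfplane a \<beta>" if "real_vec a' \<bullet> x \<le> real_of_int \<beta>'" for x
  proof -
    have "real_of_int g * (real_vec a' \<bullet> x) \<le> real_of_int g * real_of_int \<beta>'"
      using that g by (intro mult_left_mono) auto
    then show ?thesis using floor(1) by (simp add: halfplane_def ax)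
  qed
  have "split_hull (halfplane a \<beta>) a' \<beta>' \<subseteq> halfplane a' \<beta>'"
    unfolding split_hull_def
  proof (rule hull_minimal)
    \<comment> \<open>The far side of this split is empty, since
      \<open>\<beta> < g * (\<beta>' + 1)\<close>; the two assumptions contradict each
      other.\<close>
    have "x \<in> halfplane a' \<beta>'" if "x \<in> halfplane a \<beta>" "real_of_int (\<beta>' + 1) \<le> real_vec a' \<bullet> x" for x
    proof -
      have "real_of_int g * (real_of_int \<beta>' + 1) \<le> real_of_int g * (real_vec a' \<bullet> x)"
        using that(2) g by (intro mult_left_mono) auto
      then show ?thesis using that(1) floor(2) by (simp add: halfplane_def ax)
    qed
    then show "halfplane a \<beta> \<inter> {x. real_vec a' \<bullet> x \<le> real_of_int \<beta>'} \<union>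
      halfplane a \<beta> \<inter> {x. real_of_int (\<beta>' + 1) \<le> real_vec a' \<bullet> x} \<subseteq> halfplane a' \<beta>'"
      by (auto simp: halfplane_def)
  qed (rule convex_halfplane)
  then have "split_closure (halfplane a \<beta>) \<subseteq> halfplane a' \<beta>'"
    using a'0 by (auto simp: split_closure_def)
  moreover have key: "x \<in> split_hull (halfplane a \<beta>) \<pi> \<pi>0" if x: "x \<in> halfplane a' \<beta>'" and \<pi>: "\<pi> \<noteq> 0" for x \<pi> \<pi>0
  proof (cases "real_of_int \<pi>0 < real_vec \<pi> \<bullet> x \<and> real_vec \<pi> \<bullet> x < real_of_int (\<pi>0 + 1)")
    case False
    then show ?thesis using x sub by (intro in_split_hull_outside_strip) (auto simp: halfplane_def)
  next
    case strip: True
    define \<mu> where "\<mu> = real_vec \<pi> \<bullet> x - real_of_int \<pi>0"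
    have x': "real_vec a' \<bullet> x \<le> real_of_int \<beta>'" using x by (simp add: halfplane_def)
    have "\<exists>d. real_vec \<pi> \<bullet> d = 1 \<and> real_vec a' \<bullet> (x - \<mu> *\<^sub>R d) \<le> real_of_int \<beta>' \<and>
      real_vec a' \<bullet> (x + (1 - \<mu>) *\<^sub>R d) \<le> real_of_int \<beta>'"
    proof (cases "det2 a' \<pi> = 0")
      case False
      \<comment> \<open>The boundary direction of the half-plane, scaled to advance by one across
        the strip.\<close>
      define d :: "real^2" where "d = (1 / real_of_int (det2 a' \<pi>)) *\<^sub>R vector [- real_of_int (a' $ 2), real_of_int (a' $ 1)]"
      have "real_vec a' \<bullet> d = 0" by (simp add: d_def real_vec_inner)
      moreover have "real_vec \<pi> \<bullet> d = (real_of_int (a' $ 1) * real_of_int (\<pi> $ 2)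
          - real_of_int (a' $ 2) * real_of_int (\<pi> $ 1)) / real_of_int (det2 a' \<pi>)"
        by (simp add: d_def real_vec_inner diff_divide_distrib mult.commute)
      then have "real_vec \<pi> \<bullet> d = real_of_int (det2 a' \<pi>) / real_of_int (det2 a' \<pi>)"
        by (simp add: det2_def)
      then have "real_vec \<pi> \<bullet> d = 1" using False by simp
      ultimately show ?thesis using x' by (intro exI[of _ d]) (simp add: inner_diff_right inner_add_right)
    next
      case par: True
      \<comment> \<open>The Bezout coefficients of the primitive normal \<open>a'\<close> exhibit
        the parallel vector \<open>\<pi>\<close> as its integer multiple by
        \<open>k\<close>.\<close>
      define k where "k = u * \<pi> $ 1 + v * \<pi> $ 2"
      have e: "a' $ 1 * \<pi> $ 2 = a' $ 2 * \<pi> $ 1" using par by (simp add: det2_def)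
      have "k * a' $ 1 = (u * a' $ 1 + v * a' $ 2) * \<pi> $ 1" "k * a' $ 2 = (u * a' $ 1 + v * a' $ 2) * \<pi> $ 2"
        using e unfolding k_def by (simp_all add: algebra_simps)
      then have \<pi>k: "\<pi> $ 1 = k * a' $ 1" "\<pi> $ 2 = k * a' $ 2" using uv by simp_all
      have px: "real_vec \<pi> \<bullet> y = real_of_int k * (real_vec a' \<bullet> y)" for y
        by (simp add: real_vec_inner \<pi>k algebra_simps)
      have k: "k \<noteq> 0" using \<pi> \<pi>k by (auto simp: int_vec2_eq_0_iff)
      define n where "n = real_vec a' \<bullet> real_vec a'"
      have n: "n \<noteq> 0" using a'0 by (auto simp: n_def int_vec2_eq_0_iff vec_eq_iff forall_2)
      define d where "d = (1 / (real_of_int k * n)) *\<^sub>R real_vec a'"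
      have d: "real_vec a' \<bullet> d = 1 / real_of_int k" using n by (simp add: d_def n_def[symmetric])
      have val: "real_vec a' \<bullet> (x - \<mu> *\<^sub>R d) = real_of_int \<pi>0 / real_of_int k"
        "real_vec a' \<bullet> (x + (1 - \<mu>) *\<^sub>R d) = (real_of_int \<pi>0 + 1) / real_of_int k"
        using k by (simp_all add: inner_diff_right inner_add_right d \<mu>_def px field_simps)
      \<comment> \<open>The integer \<open>k * \<beta>'\<close> cannot lie strictly between
        \<open>\<pi>0\<close> and \<open>\<pi>0 + 1\<close>, and the position of \<open>x\<close>
        decides on which side it falls.\<close>
      have "real_of_int \<pi>0 / real_of_int k \<le> real_of_int \<beta>' \<and> (real_of_int \<pi>0 + 1) / real_of_int k \<le> real_of_int \<beta>'"
      proof (cases "0 < k")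
        case True
        have "real_of_int \<pi>0 < real_of_int k * real_of_int \<beta>'"
          using conjunct1[OF strip] mult_left_mono[OF x', of "real_of_int k"] True unfolding px by linarith
        then have "\<pi>0 < k * \<beta>'" unfolding of_int_mult[symmetric] of_int_less_iff .
        then have "\<pi>0 + 1 \<le> k * \<beta>'" by simp
        then have "real_of_int (\<pi>0 + 1) \<le> real_of_int (k * \<beta>')"
          by (simp only: of_int_le_iff)
        then have "real_of_int \<pi>0 + 1 \<le> real_of_int k * real_of_int \<beta>'" by simp
        then show ?thesis using True by (simp add: pos_divide_le_eq mult.commute)
      next
        case False
        then have k: "k < 0" using k by simp
        have "real_of_int k * real_of_int \<beta>' < real_of_int (\<pi>0 + 1)"
          using conjunct2[OF strip] mult_left_mono_neg[OF x', of "real_of_int k"] k unfolding px by linarith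
        then have "k * \<beta>' < \<pi>0 + 1" unfolding of_int_mult[symmetric] of_int_less_iff .
        then have "k * \<beta>' \<le> \<pi>0" by simp
        then have "real_of_int k * real_of_int \<beta>' \<le> real_of_int \<pi>0"
          unfolding of_int_mult[symmetric] of_int_le_iff .
        then show ?thesis using k by (simp add: neg_divide_le_eq mult.commute)
      qed
      then show ?thesis using val d k px by (intro exI[of _ d]) simp
    qed
    then obtain d where "real_vec \<pi> \<bullet> d = 1" "x - \<mu> *\<^sub>R d \<in> halfplane a \<beta>" "x + (1 - \<mu>) *\<^sub>R d \<in> halfplane a \<beta>"
      using sub by blast
    then show ?thesis
      using in_split_hull_strip_iff[OF convex_halfplane, of \<pi>0 \<pi> x] strip unfolding \<mu>_def by auto
  qed
  have "halfplane a' \<beta>' \<subseteq> split_closure (halfplane a \<beta>)"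
    using key by (auto simp: split_closure_def)
  ultimately have "split_closure (halfplane a \<beta>) = halfplane a' \<beta>'" by auto
  moreover have "\<bar>a' $ j\<bar> \<le> \<bar>a $ j\<bar>" for j using abs_div_le_abs[OF g] by (simp add: a'_def)
  moreover have "\<bar>\<beta>'\<bar> \<le> \<bar>\<beta>\<bar>" using abs_div_le_abs[OF g] by (simp add: \<beta>'_def)
  ultimately show ?thesis using that by blast
qed

subsection \<open>The split closure of a cone\<close>

definition slack :: "int^2 \<Rightarrow> int \<Rightarrow> real^2 \<Rightarrow> real" where
  "slack a \<beta> x = real_of_int \<beta> - real_vec a \<bullet> x"

lemma halfplane_iff_slack: "x \<in> halfplane a \<beta> \<longleftrightarrow> 0 \<le> slack a \<beta> x"
  by (simp add: halfplane_def slack_def)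

text \<open>
  In terms of the slacks \<open>s\<close> and \<open>t\<close> of the two inequalities and of \<open>D = det2 a a'\<close>, the triple
  \<open>(P, Q, T)\<close> satisfies \<open>D * (\<pi> x - \<pi>0) = T + P * s + Q * t\<close>.
\<close>

definition split_triple :: "int^2 \<Rightarrow> int \<Rightarrow> int^2 \<Rightarrow> int \<Rightarrow> int^2 \<Rightarrow> int \<Rightarrow> int \<times> int \<times> int" where
  "split_triple a \<beta> a' \<beta>' \<pi> \<pi>0 =
    (- det2 \<pi> a', - det2 a \<pi>, det2 \<pi> a' * \<beta> + det2 a \<pi> * \<beta>' - det2 a a' * \<pi>0)"

text \<open>Cramer's rule: \<open>det2 a a'\<close> times \<open>\<pi>\<close> is
  \<open>det2 \<pi> a'\<close> times \<open>a\<close> plus \<open>det2 a \<pi>\<close> times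
  \<open>a'\<close>.\<close>

lemma split_triple_eq:
  assumes "split_triple a \<beta> a' \<beta>' \<pi> \<pi>0 = (P, Q, T)"
  shows "real_of_int (det2 a a') * (real_vec \<pi> \<bullet> x - real_of_int \<pi>0)
    = real_of_int T + real_of_int P * slack a \<beta> x + real_of_int Q * slack a' \<beta>' x"
proof -
  have P: "P = - det2 \<pi> a'" and Q: "Q = - det2 a \<pi>"
    and T: "T = det2 \<pi> a' * \<beta> + det2 a \<pi> * \<beta>' - det2 a a' * \<pi>0"
    using assms by (auto simp: split_triple_def)
  show ?thesis
    unfolding P Q T slack_def real_vec_inner det2_def of_int_diff of_int_add of_int_mult of_int_minus
    by algebra
qed

text \<open>By Cramer's rule the two slacks are affine coordinates of the plane; this is their
  injectivity, and \<open>slack_surj\<close> their surjectivity.\<close>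

lemma slack_eqI:
  assumes "det2 a a' \<noteq> 0" "slack a \<beta> x = slack a \<beta> y" "slack a' \<beta>' x = slack a' \<beta>' y"
  shows "x = y"
proof -
  define z where "z = x - y"
  define D where "D = real_of_int (det2 a a')"
  have z: "real_vec a \<bullet> z = 0" "real_vec a' \<bullet> z = 0" using assms(2,3) by (auto simp: slack_def z_def inner_diff_right)
  have "D * z $ 1 = real_of_int (a' $ 2) * (real_vec a \<bullet> z) - real_of_int (a $ 2) * (real_vec a' \<bullet> z)"
    "D * z $ 2 = real_of_int (a $ 1) * (real_vec a' \<bullet> z) - real_of_int (a' $ 1) * (real_vec a \<bullet> z)"
    by (simp_all add: real_vec_inner D_def det2_def algebra_simps)
  moreover have "D \<noteq> 0" using assms(1) by (simp add: D_def)
  ultimately have "z $ 1 = 0" "z $ 2 = 0" unfolding z by auto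
  then show ?thesis by (simp add: z_def vec_eq_iff forall_2)
qed

lemma slack_surj:
  assumes "det2 a a' \<noteq> 0"
  obtains x where "slack a \<beta> x = s" "slack a' \<beta>' x = t"
proof -
  define D where "D = real_of_int (det2 a a')"
  define u v where "u = real_of_int \<beta> - s" and "v = real_of_int \<beta>' - t"
  define x :: "real^2" where "x = vector [(u * real_of_int (a' $ 2) - v * real_of_int (a $ 2)) / D,
    (v * real_of_int (a $ 1) - u * real_of_int (a' $ 1)) / D]"
  have D: "D \<noteq> 0" "D = real_of_int (a $ 1) * real_of_int (a' $ 2) - real_of_int (a $ 2) * real_of_int (a' $ 1)"
    using assms by (simp_all add: D_def) (simp add: det2_def)
  have "D * (real_vec a \<bullet> x) = D * u" "D * (real_vec a' \<bullet> x) = D * v"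
    using D(1) by (simp_all add: real_vec_inner x_def distrib_left) (simp_all add: D(2) algebra_simps)
  then have "real_vec a \<bullet> x = u" "real_vec a' \<bullet> x = v" using D(1) by auto
  then show ?thesis using that[of x] by (simp add: slack_def u_def v_def)
qed

lemma slack_add_scaleR: "slack a \<beta> (x + c *\<^sub>R d) = slack a \<beta> x - c * (real_vec a \<bullet> d)"
  by (simp add: slack_def inner_add_right)

lemma slack_convex_comb:
  "u + v = 1 \<Longrightarrow> slack a \<beta> (u *\<^sub>R x + v *\<^sub>R y) = u * slack a \<beta> x + v * slack a \<beta> y"
  by (simp add: slack_def inner_add_right algebra_simps flip: distrib_right)

text \<open>A split whose strip does not contain the apex cuts nothing off: extend the ray from the apex.\<close>

lemma cone_subset_split_hull:
  assumes D: "0 < det2 a a'" and st: "split_triple a \<beta> a' \<beta>' \<pi> \<pi>0 = (P, Q, T)"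
    and T: "T \<le> 0 \<or> det2 a a' \<le> T"
  shows "halfplane a \<beta> \<inter> halfplane a' \<beta>' \<subseteq> split_hull (halfplane a \<beta> \<inter> halfplane a' \<beta>') \<pi> \<pi>0"
proof
  fix x assume x: "x \<in> halfplane a \<beta> \<inter> halfplane a' \<beta>'"
  show "x \<in> split_hull (halfplane a \<beta> \<inter> halfplane a' \<beta>') \<pi> \<pi>0"
  proof (cases "real_of_int \<pi>0 < real_vec \<pi> \<bullet> x \<and> real_vec \<pi> \<bullet> x < real_of_int (\<pi>0 + 1)")
    case False
    then show ?thesis using x by (intro in_split_hull_outside_strip)
  next
    case True
    obtain v where v: "slack a \<beta> v = 0" "slack a' \<beta>' v = 0"
      using slack_surj[of a a' \<beta> 0 \<beta>' 0] D by force
    define \<mu> where "\<mu> = real_vec \<pi> \<bullet> x - real_of_int \<pi>0"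
    define t where "t = real_of_int T / real_of_int (det2 a a')"
    have mu: "0 < \<mu>" "\<mu> < 1" using True by (auto simp: \<mu>_def)
    have pv: "real_vec \<pi> \<bullet> v - real_of_int \<pi>0 = t"
      using split_triple_eq[OF st, of v] D v by (simp add: t_def field_simps)
    have t: "t \<le> 0 \<or> 1 \<le> t" using T D by (auto simp: t_def divide_nonpos_pos)
    \<comment> \<open>The direction of the line through the apex \<open>v\<close> and
      \<open>x\<close>. The number \<open>t\<close> is the position of the apex relative to the
      strip, hence not strictly between 0 and 1.\<close>
    define d where "d = (1 / (\<mu> - t)) *\<^sub>R (x - v)"
    have ne: "\<mu> - t \<noteq> 0" using mu t by auto
    have pxv: "real_vec \<pi> \<bullet> (x - v) = \<mu> - t" using pv by (simp add: inner_diff_right \<mu>_def)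
    have pd: "real_vec \<pi> \<bullet> d = 1" using ne by (simp add: d_def pxv)
    \<comment> \<open>The boundary points are \<open>v\<close> plus these multiples of
      \<open>x - v\<close>; nonnegative factors keep them on the ray and thus in the cone.\<close>
    have coeff: "0 \<le> 1 - \<mu> / (\<mu> - t)" "0 \<le> 1 + (1 - \<mu>) / (\<mu> - t)"
    proof -
      have "1 - \<mu> / (\<mu> - t) = - t / (\<mu> - t)" "1 + (1 - \<mu>) / (\<mu> - t) = (1 - t) / (\<mu> - t)"
        using ne by (simp_all add: field_simps)
      moreover have "0 \<le> - t / (\<mu> - t) \<and> 0 \<le> (1 - t) / (\<mu> - t)"
      proof (cases "t \<le> 0")
        case True
        then show ?thesis using mu by (intro conjI divide_nonneg_pos) linarith+
      next
        case False
        then show ?thesis using mu t by (intro conjI divide_nonpos_neg) linarith+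
      qed
      ultimately show "0 \<le> 1 - \<mu> / (\<mu> - t)" "0 \<le> 1 + (1 - \<mu>) / (\<mu> - t)" by simp_all
    qed
    have both: "x - \<mu> *\<^sub>R d \<in> halfplane c \<gamma> \<and> x + (1 - \<mu>) *\<^sub>R d \<in> halfplane c \<gamma>"
      if c: "0 \<le> slack c \<gamma> x" "slack c \<gamma> v = 0" for c \<gamma>
    proof -
      have cd: "real_vec c \<bullet> d = - slack c \<gamma> x / (\<mu> - t)"
        using c(2) by (simp add: d_def slack_def inner_diff_right)
      have "slack c \<gamma> (x + (- \<mu>) *\<^sub>R d) = (1 - \<mu> / (\<mu> - t)) * slack c \<gamma> x"
        "slack c \<gamma> (x + (1 - \<mu>) *\<^sub>R d) = (1 + (1 - \<mu>) / (\<mu> - t)) * slack c \<gamma> x"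
        unfolding slack_add_scaleR cd by (simp_all add: algebra_simps)
      then have "0 \<le> slack c \<gamma> (x + (- \<mu>) *\<^sub>R d)" "0 \<le> slack c \<gamma> (x + (1 - \<mu>) *\<^sub>R d)"
        using coeff c(1) by simp_all
      then show ?thesis by (simp add: halfplane_iff_slack)
    qed
    have "x - \<mu> *\<^sub>R d \<in> halfplane a \<beta> \<inter> halfplane a' \<beta>'"
      "x + (1 - \<mu>) *\<^sub>R d \<in> halfplane a \<beta> \<inter> halfplane a' \<beta>'"
      using both[of a \<beta>] both[of a' \<beta>'] v x by (auto simp: halfplane_iff_slack)
    then show ?thesis
      using in_split_hull_strip_iff[OF convex_Int[OF convex_halfplane convex_halfplane], of \<pi>0 \<pi> x a \<beta> a' \<beta>']
        True pd unfolding \<mu>_def by auto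
  qed
qed

text \<open>The coefficient is the reciprocal of the slack at the exit from the strip, so a product
  of at least one means that the edge point with slack \<open>w\<close> has reached or passed the
  exit.\<close>

lemma cut_coeff_far:
  assumes T: "0 < T" "T < D" and P: "P \<noteq> 0" and w: "1 \<le> cut_coeff D T P * w"
  shows "real_of_int (D - T) \<le> real_of_int P * w \<or> real_of_int P * w \<le> - real_of_int T"
proof (cases "0 \<le> P")
  case True
  then show ?thesis using T w by (simp add: cut_coeff_nonneg_arg le_divide_eq)
next
  case False
  then have "cut_coeff D T P * w = - (real_of_int P * w) / real_of_int T"
    using T by (simp add: cut_coeff_nonpos_arg)
  then have "1 \<le> - (real_of_int P * w) / real_of_int T" using w by simp
  then have "1 * real_of_int T \<le> - (real_of_int P * w)" using T by (subst (asm) pos_le_divide_eq) auto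
  then show ?thesis by linarith
qed

lemma cut_coeff_pos:
  assumes T: "0 < T" "T < D" and P: "P \<noteq> 0"
  shows "0 < cut_coeff D T P"
proof (cases "0 \<le> P")
  case True
  then show ?thesis using T P by (simp add: cut_coeff_nonneg_arg)
next
  case False
  then show ?thesis using T by (simp add: cut_coeff_nonpos_arg divide_neg_pos)
qed

lemma cut_coeff_0 [simp]: "cut_coeff D T 0 = 0"
  by (simp add: cut_coeff_def)

text \<open>On each side of the strip one of the two families of quotients proves the cut, and the
  maxima dominate both since slacks are nonnegative. Conversely, a point satisfying the cut lies
  outside the strip or between two edge points that do.\<close>

lemma split_hull_cone_iff:
  assumes st: "split_triple a \<beta> a' \<beta>' \<pi> \<pi>0 = (P, Q, T)" and T: "0 < T" "T < det2 a a'"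
  shows "x \<in> split_hull (halfplane a \<beta> \<inter> halfplane a' \<beta>') \<pi> \<pi>0 \<longleftrightarrow>
    x \<in> halfplane a \<beta> \<inter> halfplane a' \<beta>' \<and> 1 \<le> cut_value (det2 a a') (P, Q, T) (slack a \<beta> x, slack a' \<beta>' x)"
    (is "?L \<longleftrightarrow> ?R")
proof -
  define D where "D = det2 a a'"
  have D: "0 < D" "T < D" using T by (auto simp: D_def)
  define C where "C = halfplane a \<beta> \<inter> halfplane a' \<beta>'"
  define c c' where "c = cut_coeff D T P" and "c' = cut_coeff D T Q"
  define s s' where "s = slack a \<beta>" and "s' = slack a' \<beta>'"
  have C: "x \<in> C \<longleftrightarrow> 0 \<le> s x \<and> 0 \<le> s' x" for x by (simp add: C_def s_def s'_def halfplane_iff_slack)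
  have cut: "cut_value D (P, Q, T) (s x, s' x) = c * s x + c' * s' x" for x
    by (simp add: cut_value_def c_def c'_def)
  define X where "X = C \<inter> {x. real_vec \<pi> \<bullet> x \<le> real_of_int \<pi>0} \<union> C \<inter> {x. real_of_int (\<pi>0 + 1) \<le> real_vec \<pi> \<bullet> x}"
  have hull: "split_hull C \<pi> \<pi>0 = convex hull X" by (simp add: split_hull_def X_def)
  have val: "real_of_int D * (real_vec \<pi> \<bullet> x - real_of_int \<pi>0) = real_of_int T + real_of_int P * s x + real_of_int Q * s' x" for x
    using split_triple_eq[OF st] by (simp add: D_def s_def s'_def)
  have left: "real_vec \<pi> \<bullet> x \<le> real_of_int \<pi>0 \<longleftrightarrow> real_of_int P * s x + real_of_int Q * s' x \<le> - real_of_int T" for x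
  proof -
    have "real_vec \<pi> \<bullet> x \<le> real_of_int \<pi>0 \<longleftrightarrow> real_of_int D * (real_vec \<pi> \<bullet> x - real_of_int \<pi>0) \<le> 0"
      using D(1) by (simp add: mult_le_0_iff)
    then show ?thesis unfolding val by auto
  qed
  have right: "real_of_int (\<pi>0 + 1) \<le> real_vec \<pi> \<bullet> x \<longleftrightarrow> real_of_int (D - T) \<le> real_of_int P * s x + real_of_int Q * s' x" for x
  proof -
    have "real_of_int (\<pi>0 + 1) \<le> real_vec \<pi> \<bullet> x \<longleftrightarrow> real_of_int D * 1 \<le> real_of_int D * (real_vec \<pi> \<bullet> x - real_of_int \<pi>0)"
      using D(1) by (subst mult_le_cancel_left_pos) auto
    then show ?thesis unfolding val by auto
  qed
  have X: "x \<in> X \<longleftrightarrow> 0 \<le> s x \<and> 0 \<le> s' x \<and> (real_of_int P * s x + real_of_int Q * s' x \<le> - real_of_int T \<or>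
      real_of_int (D - T) \<le> real_of_int P * s x + real_of_int Q * s' x)" for x
    unfolding X_def using C left right by auto
  have le: "real_of_int P / real_of_int (D - T) \<le> c" "- real_of_int P / real_of_int T \<le> c"
    "real_of_int Q / real_of_int (D - T) \<le> c'" "- real_of_int Q / real_of_int T \<le> c'"
    by (auto simp: c_def c'_def cut_coeff_def)
  have sub: "split_hull C \<pi> \<pi>0 \<subseteq> C \<inter> {x. 1 \<le> c * s x + c' * s' x}"
    unfolding hull
  proof (rule hull_minimal)
    show "X \<subseteq> C \<inter> {x. 1 \<le> c * s x + c' * s' x}"
    proof
      fix x assume x: "x \<in> X"
      then have pos: "0 \<le> s x" "0 \<le> s' x" using X by auto
      have 1: "real_of_int P / real_of_int (D - T) * s x + real_of_int Q / real_of_int (D - T) * s' x \<le> c * s x + c' * s' x"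
        using le pos by (intro add_mono mult_right_mono) auto
      have 2: "- real_of_int P / real_of_int T * s x + - real_of_int Q / real_of_int T * s' x \<le> c * s x + c' * s' x"
        using le pos by (intro add_mono mult_right_mono) auto
      have "1 \<le> real_of_int P / real_of_int (D - T) * s x + real_of_int Q / real_of_int (D - T) * s' x \<or>
        1 \<le> - real_of_int P / real_of_int T * s x + - real_of_int Q / real_of_int T * s' x"
      proof -
        have e: "real_of_int P / real_of_int (D - T) * s x + real_of_int Q / real_of_int (D - T) * s' x
            = (real_of_int P * s x + real_of_int Q * s' x) / real_of_int (D - T)"
          "- real_of_int P / real_of_int T * s x + - real_of_int Q / real_of_int T * s' x
            = - (real_of_int P * s x + real_of_int Q * s' x) / real_of_int T"
          by (simp_all add: add_divide_distrib diff_divide_distrib)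
        show ?thesis unfolding e using x X[of x] T D by (auto simp: le_divide_eq)
      qed
      then show "x \<in> C \<inter> {x. 1 \<le> c * s x + c' * s' x}" using 1 2 pos C by auto
    qed
    have "{x. 1 \<le> c * s x + c' * s' x} =
      {x. (c *\<^sub>R real_vec a + c' *\<^sub>R real_vec a') \<bullet> x \<le> c * real_of_int \<beta> + c' * real_of_int \<beta>' - 1}"
      by (auto simp: s_def s'_def slack_def inner_add_left algebra_simps)
    then show "convex (C \<inter> {x. 1 \<le> c * s x + c' * s' x})"
      unfolding C_def by (simp only:) (intro convex_Int convex_halfplane convex_halfspace_le)
  qed
  have sup: "x \<in> convex hull X" if x: "x \<in> C" "1 \<le> c * s x + c' * s' x" for x
  proof -
    have pos: "0 \<le> s x" "0 \<le> s' x" using x(1) C by auto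
    define \<sigma> where "\<sigma> = c * s x + c' * s' x"
    have sig: "1 \<le> \<sigma>" using x by (simp add: \<sigma>_def)
    consider "P = 0" | "Q = 0" | "P \<noteq> 0" "Q \<noteq> 0" by blast
    then show ?thesis
    proof cases
      case 1
      \<comment> \<open>An edge parallel to the strip has no exit point, but then \<open>x\<close>
        itself is already outside the open strip.\<close>
      then have w: "1 \<le> c' * s' x" using x(2) by (simp add: c_def)
      then have "Q \<noteq> 0" by (auto simp: c'_def)
      then have "x \<in> X"
        using cut_coeff_far[OF T(1) D(2) _ w[unfolded c'_def]] pos 1 unfolding X by auto
      then show ?thesis by (rule hull_inc)
    next
      case 2
      then have w: "1 \<le> c * s x" using x(2) by (simp add: c'_def)
      then have "P \<noteq> 0" by (auto simp: c_def)
      then have "x \<in> X"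
        using cut_coeff_far[OF T(1) D(2) _ w[unfolded c_def]] pos 2 unfolding X by auto
      then show ?thesis by (rule hull_inc)
    next
      case 3
      have cpos: "0 < c" "0 < c'" using cut_coeff_pos[OF T(1) D(2)] 3 by (auto simp: c_def c'_def)
      have D0: "det2 a a' \<noteq> 0" using D by (simp add: D_def)
      \<comment> \<open>The points on the two edges with the same cut value \<open>\<sigma>\<close>
        as \<open>x\<close>. Since \<open>1 \<le> \<sigma>\<close> both are outside the open strip,
        and \<open>x\<close> lies on the segment between them.\<close>
      obtain y where y: "s y = \<sigma> / c" "s' y = 0"
        using slack_surj[OF D0, of \<beta> "\<sigma> / c" \<beta>' 0] unfolding s_def s'_def by blast
      obtain z where z: "s z = 0" "s' z = \<sigma> / c'"
        using slack_surj[OF D0, of \<beta> 0 \<beta>' "\<sigma> / c'"] unfolding s_def s'_def by blast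
      have "1 \<le> c * (\<sigma> / c)" "1 \<le> c' * (\<sigma> / c')" using cpos sig by auto
      then have "y \<in> X" "z \<in> X"
        using cut_coeff_far[OF T(1) D(2) 3(1), of "\<sigma> / c"] cut_coeff_far[OF T(1) D(2) 3(2), of "\<sigma> / c'"]
          y z cpos sig unfolding X c_def c'_def by auto
      then have yz: "y \<in> convex hull X" "z \<in> convex hull X" by (auto intro: hull_inc)
      define u v where "u = c * s x / \<sigma>" and "v = c' * s' x / \<sigma>"
      have uv: "0 \<le> u" "0 \<le> v" "u + v = 1"
        using cpos pos sig by (auto simp: u_def v_def \<sigma>_def simp flip: add_divide_distrib)
      have "u *\<^sub>R y + v *\<^sub>R z = x"
      proof (rule slack_eqI[OF D0])
        have "s (u *\<^sub>R y + v *\<^sub>R z) = u * s y + v * s z" "s' (u *\<^sub>R y + v *\<^sub>R z) = u * s' y + v * s' z"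
          using uv(3) by (simp_all add: s_def s'_def slack_convex_comb)
        then show "slack a \<beta> (u *\<^sub>R y + v *\<^sub>R z) = slack a \<beta> x" "slack a' \<beta>' (u *\<^sub>R y + v *\<^sub>R z) = slack a' \<beta>' x"
          using y z cpos sig by (simp_all add: s_def s'_def u_def v_def)
      qed
      moreover have "u *\<^sub>R y + v *\<^sub>R z \<in> convex hull X"
        using uv by (intro convexD[OF convex_convex_hull yz])
      ultimately show ?thesis by simp
    qed
  qed
  have "x \<in> split_hull C \<pi> \<pi>0 \<longleftrightarrow> x \<in> C \<and> 1 \<le> c * s x + c' * s' x"
    using sub sup unfolding hull by blast
  then show ?thesis using cut[of x] unfolding C_def D_def s_def s'_def by simp
qed

text \<open>The cut multiplied by \<open>T * (D - T)\<close>, which clears both possible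
  denominators, and rewritten from the slacks to the original coordinates.\<close>

definition cut_row :: "int^2 \<Rightarrow> int \<Rightarrow> int^2 \<Rightarrow> int \<Rightarrow> int \<times> int \<times> int \<Rightarrow> (int^2) \<times> int" where
  "cut_row a \<beta> a' \<beta>' = (\<lambda>(P, Q, T).
    let D = det2 a a'; N = max (P * T) (- P * (D - T)); N' = max (Q * T) (- Q * (D - T))
    in (\<chi> j. N * a $ j + N' * a' $ j, N * \<beta> + N' * \<beta>' - T * (D - T)))"

lemma scaled_cut_coeff:
  assumes "0 < T" "T < D"
  shows "real_of_int (max (P * T) (- P * (D - T))) = real_of_int (T * (D - T)) * cut_coeff D T P"
proof (cases "0 \<le> P")
  case True
  have "- P * (D - T) \<le> 0" "0 \<le> P * T" using assms True by (simp_all add: mult_nonpos_nonneg)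
  then have "max (P * T) (- P * (D - T)) = P * T" by linarith
  then show ?thesis using assms True by (simp add: cut_coeff_nonneg_arg)
next
  case False
  have "0 \<le> - P * (D - T)" "P * T \<le> 0" using assms False by (simp_all add: mult_nonpos_nonneg)
  then have "max (P * T) (- P * (D - T)) = - P * (D - T)" by linarith
  then show ?thesis using assms False by (simp add: cut_coeff_nonpos_arg)
qed

lemma halfplane_cut_row:
  assumes T: "0 < T" "T < det2 a a'" and row: "cut_row a \<beta> a' \<beta>' (P, Q, T) = (c, \<gamma>)"
  shows "x \<in> halfplane c \<gamma> \<longleftrightarrow> 1 \<le> cut_value (det2 a a') (P, Q, T) (slack a \<beta> x, slack a' \<beta>' x)"
proof -
  define D where "D = det2 a a'"
  define N N' where "N = max (P * T) (- P * (D - T))" and "N' = max (Q * T) (- Q * (D - T))"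
  define w where "w = real_of_int (T * (D - T))"
  have w: "0 < w" using T by (simp add: w_def D_def)
  have N: "real_of_int N = w * cut_coeff D T P" "real_of_int N' = w * cut_coeff D T Q"
    using scaled_cut_coeff T unfolding N_def N'_def w_def D_def by blast+
  have c: "c = (\<chi> j. N * a $ j + N' * a' $ j)" "\<gamma> = N * \<beta> + N' * \<beta>' - T * (D - T)"
    using row by (auto simp: cut_row_def Let_def N_def N'_def D_def)
  have "real_of_int \<gamma> - real_vec c \<bullet> x = real_of_int N * slack a \<beta> x + real_of_int N' * slack a' \<beta>' x - w"
    by (simp add: c w_def slack_def real_vec_inner algebra_simps)
  also have "\<dots> = w * (cut_value D (P, Q, T) (slack a \<beta> x, slack a' \<beta>' x) - 1)"
    by (simp add: N cut_value_def algebra_simps)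
  finally have "x \<in> halfplane c \<gamma> \<longleftrightarrow> 0 \<le> w * (cut_value D (P, Q, T) (slack a \<beta> x, slack a' \<beta>' x) - 1)"
    unfolding halfplane_def by simp linarith
  then show ?thesis using w by (simp add: zero_le_mult_iff D_def)
qed

text \<open>For a reduced triple the multipliers \<open>N\<close> and \<open>N'\<close> are at most
  \<open>D * D\<close> in absolute value, so the entries of the row stay polynomial in the input
  numbers.\<close>

lemma cut_row_bounds:
  assumes T: "0 < T" "T < det2 a a'" and PQ: "\<bar>P\<bar> < det2 a a'" "\<bar>Q\<bar> < det2 a a'"
    and row: "cut_row a \<beta> a' \<beta>' (P, Q, T) = (c, \<gamma>)"
    and bd: "\<And>j. \<bar>a $ j\<bar> \<le> \<alpha>" "\<And>j. \<bar>a' $ j\<bar> \<le> \<alpha>" "\<bar>\<beta>\<bar> \<le> B" "\<bar>\<beta>'\<bar> \<le> B"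
  shows "\<bar>c $ j\<bar> \<le> 2 * (det2 a a')\<^sup>2 * \<alpha>" "\<bar>\<gamma>\<bar> \<le> 2 * (det2 a a')\<^sup>2 * B + (det2 a a')\<^sup>2"
proof -
  define D where "D = det2 a a'"
  define N N' where "N = max (P * T) (- P * (D - T))" and "N' = max (Q * T) (- Q * (D - T))"
  have mult_le: "\<bar>u * v\<bar> \<le> x * y" if "\<bar>u\<bar> \<le> x" "\<bar>v\<bar> \<le> y" for u v x y :: int
    using mult_mono[OF that] that by (simp add: abs_mult)
  have m: "\<bar>max (R * T) (- R * (D - T))\<bar> \<le> D\<^sup>2" if "\<bar>R\<bar> < D" for R
  proof -
    have "\<bar>R * T\<bar> \<le> D * D" "\<bar>- R * (D - T)\<bar> \<le> D * D"
      using that T by (intro mult_le; simp add: D_def)+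
    then show ?thesis unfolding power2_eq_square by linarith
  qed
  have N: "\<bar>N\<bar> \<le> D\<^sup>2" "\<bar>N'\<bar> \<le> D\<^sup>2" unfolding N_def N'_def using m PQ by (auto simp: D_def)
  have c: "c = (\<chi> j. N * a $ j + N' * a' $ j)" "\<gamma> = N * \<beta> + N' * \<beta>' - T * (D - T)"
    using row by (auto simp: cut_row_def Let_def N_def N'_def D_def)
  have "\<bar>N * a $ j\<bar> \<le> D\<^sup>2 * \<alpha>" "\<bar>N' * a' $ j\<bar> \<le> D\<^sup>2 * \<alpha>" using mult_le N bd by blast+
  then show "\<bar>c $ j\<bar> \<le> 2 * (det2 a a')\<^sup>2 * \<alpha>" unfolding D_def[symmetric] by (simp add: c)
  have "\<bar>N * \<beta>\<bar> \<le> D\<^sup>2 * B" "\<bar>N' * \<beta>'\<bar> \<le> D\<^sup>2 * B" using mult_le N bd by blast+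
  moreover have "\<bar>T * (D - T)\<bar> \<le> D * D" using T by (intro mult_le) (auto simp: D_def)
  ultimately show "\<bar>\<gamma>\<bar> \<le> 2 * (det2 a a')\<^sup>2 * B + (det2 a a')\<^sup>2"
    unfolding D_def[symmetric] c power2_eq_square by linarith
qed

text \<open>The dominating family is applied to the lattice of all split triples. A split with the
  apex outside the open strip removes nothing, and every other one is implied by a member of the
  family.\<close>

lemma split_closure_cone:
  assumes D: "0 < det2 a a'"
    and bd: "\<And>j. \<bar>a $ j\<bar> \<le> \<alpha>" "\<And>j. \<bar>a' $ j\<bar> \<le> \<alpha>" "\<bar>\<beta>\<bar> \<le> B" "\<bar>\<beta>'\<bar> \<le> B"
  obtains R where "finite R" "card R \<le> (2 * nat (bitlen (det2 a a')) + 1) ^ 4"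
    "split_closure (halfplane a \<beta> \<inter> halfplane a' \<beta>') =
      halfplane a \<beta> \<inter> halfplane a' \<beta>' \<inter> (\<Inter>(c, \<gamma>)\<in>R. halfplane c \<gamma>)"
    "\<And>c \<gamma> j. (c, \<gamma>) \<in> R \<Longrightarrow> \<bar>c $ j\<bar> \<le> 2 * (det2 a a')\<^sup>2 * \<alpha>"
    "\<And>c \<gamma>. (c, \<gamma>) \<in> R \<Longrightarrow> \<bar>\<gamma>\<bar> \<le> 2 * (det2 a a')\<^sup>2 * B + (det2 a a')\<^sup>2"
proof -
  define D where "D = det2 a a'"
  define C where "C = halfplane a \<beta> \<inter> halfplane a' \<beta>'"
  define st where "st = split_triple a \<beta> a' \<beta>'"
  \<comment> \<open>The zero normal is included so that \<open>L\<close> is closed under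
    differences.\<close>
  define L where "L = range (\<lambda>(\<pi>, \<pi>0). st \<pi> \<pi>0)"
  have memL: "st \<pi> \<pi>0 \<in> L" for \<pi> \<pi>0 unfolding L_def by auto
  have Dpos: "0 < D" using assms by (simp add: D_def)
  have diff: "q - q' \<in> L" if q: "q \<in> L" "q' \<in> L" for q q'
  proof -
    obtain \<pi> \<pi>0 \<rho> \<rho>0 where "q = st \<pi> \<pi>0" "q' = st \<rho> \<rho>0" using q unfolding L_def by auto
    then have "q - q' = st (\<pi> - \<rho>) (\<pi>0 - \<rho>0)"
      by (simp add: st_def split_triple_def det2_def algebra_simps)
    then show ?thesis using memL by simp
  qed
  have gen1: "(D * k, 0, 0) \<in> L" for k
  proof -
    \<comment> \<open>A split parallel to the first edge line with that line as its boundary: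
      \<open>T\<close> and \<open>Q\<close> vanish.\<close>
    have "st (\<chi> j. - k * a $ j) (- k * \<beta>) = (D * k, 0, 0)"
      by (simp add: st_def split_triple_def det2_def D_def algebra_simps)
    then show ?thesis using memL by metis
  qed
  have gen2: "(0, D * k, 0) \<in> L" for k
  proof -
    have "st (\<chi> j. - k * a' $ j) (- k * \<beta>') = (0, D * k, 0)"
      by (simp add: st_def split_triple_def det2_def D_def algebra_simps)
    then show ?thesis using memL by metis
  qed
  have gen3: "(0, 0, D) \<in> L"
  proof -
    have "st 0 (- 1) = (0, 0, D)" by (simp add: st_def split_triple_def det2_def D_def)
    then show ?thesis using memL by metis
  qed
  obtain S where S: "finite S" "card S \<le> (2 * nat (bitlen D) + 1) ^ 4"
    "\<And>P Q T. (P, Q, T) \<in> S \<Longrightarrow> (P, Q, T) \<in> L \<and> \<bar>P\<bar> < D \<and> \<bar>Q\<bar> < D \<and> 0 < T \<and> T < D"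
    "\<And>P Q T s. (P, Q, T) \<in> L \<Longrightarrow> 0 < T \<Longrightarrow> T < D \<Longrightarrow> 0 \<le> fst s \<Longrightarrow> 0 \<le> snd s \<Longrightarrow>
      \<exists>c\<in>S. cut_value D c s \<le> cut_value D (P, Q, T) s"
    using small_dominating_cut_family[OF Dpos diff gen1 gen2 gen3] by blast
  define R where "R = cut_row a \<beta> a' \<beta>' ` S"
  have rows: "\<exists>P Q T. (P, Q, T) \<in> S \<and> cut_row a \<beta> a' \<beta>' (P, Q, T) = (c, \<gamma>)" if "(c, \<gamma>) \<in> R" for c \<gamma>
    using that unfolding R_def by force
  have "x \<in> split_closure C \<longleftrightarrow> x \<in> C \<inter> (\<Inter>(c, \<gamma>)\<in>R. halfplane c \<gamma>)" for x
  proof (cases "x \<in> C")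
    case False
    then show ?thesis
      using split_closure_subset[OF convex_Int[OF convex_halfplane convex_halfplane]] unfolding C_def by blast
  next
    case x: True
    define s where "s = (slack a \<beta> x, slack a' \<beta>' x)"
    have s: "0 \<le> fst s" "0 \<le> snd s" using x by (auto simp: s_def C_def halfplane_iff_slack)
    have hull: "x \<in> split_hull C \<pi> \<pi>0 \<longleftrightarrow> 1 \<le> cut_value D (P, Q, T) s"
      if "st \<pi> \<pi>0 = (P, Q, T)" "0 < T" "T < D" for \<pi> \<pi>0 P Q T
      using split_hull_cone_iff[OF that(1)[unfolded st_def] that(2) that(3)[unfolded D_def]] x
      by (simp add: C_def D_def s_def)
    have row: "x \<in> halfplane c \<gamma> \<longleftrightarrow> 1 \<le> cut_value D (P, Q, T) s"
      if "cut_row a \<beta> a' \<beta>' (P, Q, T) = (c, \<gamma>)" "0 < T" "T < D" for P Q T c \<gamma>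
      using halfplane_cut_row[OF that(2) that(3)[unfolded D_def] that(1)] by (simp add: D_def s_def)
    show ?thesis
    proof
      assume cl: "x \<in> split_closure C"
      have "x \<in> halfplane c \<gamma>" if cR: "(c, \<gamma>) \<in> R" for c \<gamma>
      proof -
        obtain P Q T where q: "(P, Q, T) \<in> S" "cut_row a \<beta> a' \<beta>' (P, Q, T) = (c, \<gamma>)" using rows[OF cR] by blast
        then have T: "0 < T" "T < D" "(P, Q, T) \<in> L" using S(3) by auto
        then obtain \<pi> \<pi>0 where \<pi>: "st \<pi> \<pi>0 = (P, Q, T)" unfolding L_def by auto
        \<comment> \<open>A zero normal gives a \<open>T\<close> divisible by \<open>D\<close>,
          which cannot lie strictly between 0 and \<open>D\<close>.\<close>
        have "\<pi> \<noteq> 0"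
        proof
          assume "\<pi> = 0"
          then have "T = - (D * \<pi>0)" using \<pi> by (simp add: st_def split_triple_def det2_def D_def)
          then have "D dvd T" by simp
          then show False using T zdvd_not_zless by blast
        qed
        then have "x \<in> split_hull C \<pi> \<pi>0" using cl by (simp add: split_closure_def)
        then show ?thesis using hull[OF \<pi> T(1,2)] row[OF q(2) T(1,2)] by simp
      qed
      then show "x \<in> C \<inter> (\<Inter>(c, \<gamma>)\<in>R. halfplane c \<gamma>)" using x by auto
    next
      assume cl: "x \<in> C \<inter> (\<Inter>(c, \<gamma>)\<in>R. halfplane c \<gamma>)"
      have "x \<in> split_hull C \<pi> \<pi>0" for \<pi> \<pi>0
      proof -
        obtain P Q T where \<pi>: "st \<pi> \<pi>0 = (P, Q, T)" by (metis prod_cases3)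
        show ?thesis
        proof (cases "0 < T \<and> T < D")
          case False
          then show ?thesis
            using cone_subset_split_hull[OF D \<pi>[unfolded st_def]] x unfolding C_def D_def by fastforce
        next
          case T: True
          have "(P, Q, T) \<in> L" using memL[of \<pi> \<pi>0] \<pi> by simp
          then obtain q where q: "q \<in> S" "cut_value D q s \<le> cut_value D (P, Q, T) s" using S(4) T s by blast
          obtain P' Q' T' where q': "q = (P', Q', T')" by (metis prod_cases3)
          obtain c \<gamma> where c: "cut_row a \<beta> a' \<beta>' q = (c, \<gamma>)" by fastforce
          then have "(c, \<gamma>) \<in> R" unfolding R_def using q(1) by (metis image_eqI)
          then have "x \<in> halfplane c \<gamma>" using cl by auto
          then have "1 \<le> cut_value D q s" using row[of P' Q' T' c \<gamma>] c S(3)[of P' Q' T'] q(1) unfolding q' by auto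
          then show ?thesis using hull[OF \<pi>] T q(2) by auto
        qed
      qed
      then show "x \<in> split_closure C" by (simp add: split_closure_def)
    qed
  qed
  then have eq: "split_closure C = C \<inter> (\<Inter>(c, \<gamma>)\<in>R. halfplane c \<gamma>)" by blast
  have "\<bar>c $ j\<bar> \<le> 2 * (det2 a a')\<^sup>2 * \<alpha> \<and> \<bar>\<gamma>\<bar> \<le> 2 * (det2 a a')\<^sup>2 * B + (det2 a a')\<^sup>2" if cR: "(c, \<gamma>) \<in> R" for c \<gamma> j
  proof -
    obtain P Q T where q: "(P, Q, T) \<in> S" "cut_row a \<beta> a' \<beta>' (P, Q, T) = (c, \<gamma>)" using rows[OF cR] by blast
    then have "0 < T" "T < det2 a a'" "\<bar>P\<bar> < det2 a a'" "\<bar>Q\<bar> < det2 a a'" using S(3) by (auto simp: D_def)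
    from cut_row_bounds[OF this q(2) bd] show ?thesis by blast
  qed
  moreover have "finite R" "card R \<le> (2 * nat (bitlen (det2 a a')) + 1) ^ 4"
    using S(1,2) card_image_le[OF S(1), of "cut_row a \<beta> a' \<beta>'"] by (auto simp: R_def D_def)
  ultimately show ?thesis using that[of R] eq unfolding C_def by blast
qed

subsection \<open>Counting bits\<close>

text \<open>The constant 2 is the sign bit plus the one by which the bit length of a positive
  integer exceeds the floor of its logarithm.\<close>

lemma int_bits_le:
  assumes "real_of_int \<bar>z\<bar> \<le> M" "1 \<le> M"
  shows "real (int_bits z) \<le> 2 + log 2 M"
proof (cases "z = 0")
  case True
  then show ?thesis using assms by (simp add: int_bits_def)
next
  case False
  have "real (int_bits z) = 1 + real_of_int (bitlen \<bar>z\<bar>)"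
    using bitlen_nonneg[of "\<bar>z\<bar>"] by (simp add: int_bits_def)
  also have "\<dots> \<le> 2 + log 2 (real_of_int \<bar>z\<bar>)" using False by (simp add: bitlen_alt_def)
  also have "\<dots> \<le> 2 + log 2 M" using False assms by simp
  finally show ?thesis .
qed

lemma abs_entry_le_mat_norm_inf:
  assumes "a \<in> set A"
  shows "\<bar>a $ j\<bar> \<le> mat_norm_inf A"
proof -
  have "{\<bar>a $ j\<bar> | a j. a \<in> set A} = (\<lambda>(a, j). \<bar>a $ j\<bar>) ` (set A \<times> UNIV)" by auto
  then have "finite {\<bar>a $ j\<bar> | a j. a \<in> set A}" by simp
  then show ?thesis unfolding mat_norm_inf_def using assms by (intro Max_ge) auto
qed

lemma abs_entry_le_vec_norm_inf:
  assumes "\<beta> \<in> set b"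
  shows "\<bar>\<beta>\<bar> \<le> vec_norm_inf b"
proof -
  have "{\<bar>\<beta>\<bar> | \<beta>. \<beta> \<in> set b} = abs ` set b" by auto
  then show ?thesis unfolding vec_norm_inf_def using assms by (intro Max_ge) auto
qed

lemma norm_inf_nonneg: "0 \<le> mat_norm_inf A" "0 \<le> vec_norm_inf b"
proof -
  have "{\<bar>a $ j\<bar> | a j. a \<in> set A} = (\<lambda>(a, j). \<bar>a $ j\<bar>) ` (set A \<times> UNIV)" by auto
  then have "finite {\<bar>a $ j\<bar> | a j. a \<in> set A}" by simp
  then show "0 \<le> mat_norm_inf A" unfolding mat_norm_inf_def by (intro Max_ge) auto
  have "{\<bar>\<beta>\<bar> | \<beta>. \<beta> \<in> set b} = abs ` set b" by auto
  then show "0 \<le> vec_norm_inf b" unfolding vec_norm_inf_def by (intro Max_ge) auto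
qed

lemma encoding_size_le:
  fixes rows :: "((int^2) \<times> int) list"
  assumes "\<And>c \<gamma> j. (c, \<gamma>) \<in> set rows \<Longrightarrow> real (int_bits (c $ j)) \<le> M \<and> real (int_bits \<gamma>) \<le> M"
  shows "real (encoding_size (map fst rows) (map snd rows)) \<le> real (length rows) * (3 * M)"
  using assms
proof (induction rows)
  case Nil
  then show ?case by (simp add: encoding_size_def)
next
  case (Cons r rows)
  obtain c \<gamma> where r: "r = (c, \<gamma>)" by fastforce
  have "real (int_bits (c $ 1)) \<le> M" "real (int_bits (c $ 2)) \<le> M" "real (int_bits \<gamma>) \<le> M"
    using Cons.prems[of c \<gamma>] r by auto
  moreover have "real (encoding_size (map fst rows) (map snd rows)) \<le> real (length rows) * (3 * M)"
    by (rule Cons.IH) (use Cons.prems in auto)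
  ultimately show ?case by (simp add: encoding_size_def sum_2 r algebra_simps)
qed

lemma abs_det2_le:
  assumes "\<And>j. \<bar>a $ j\<bar> \<le> \<alpha>" "\<And>j. \<bar>a' $ j\<bar> \<le> \<alpha>"
  shows "\<bar>det2 a a'\<bar> \<le> 2 * \<alpha>\<^sup>2"
proof -
  have "\<bar>a $ i * a' $ j\<bar> \<le> \<alpha> * \<alpha>" for i j
    using mult_mono[OF assms(1)[of i] assms(2)[of j]] assms(1)[of i] by (simp add: abs_mult)
  from this[of 1 2] this[of 2 1] show ?thesis unfolding det2_def power2_eq_square by linarith
qed

section \<open>Assembling the description and bounding its size\<close>

theorem theorem20:
  shows "\<exists>p :: real \<times> real \<times> real \<Rightarrow> real. real_polynomial_function p \<and>
    (\<forall>(m :: nat) (A :: (int^2) list) (b :: int list) (P :: (real^2) set).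
      is_description m A b P \<longrightarrow>
      (\<exists>(m' :: nat) (A' :: (int^2) list) (b' :: int list).
        is_description m' A' b' (split_closure P) \<and>
        real (encoding_size A' b') \<le>
          p (real m, log_plus2 (mat_norm_inf A), log_plus2 (vec_norm_inf b))))"
proof -
  \<comment> \<open>The first factor bounds the number of rows: one per inequality and at most
    \<open>(8 * x + 1) ^ 4\<close> cuts for each of at most \<open>m * m\<close> cones. The second
    allows three integers per row with \<open>2 + (8 * x + y)\<close> bits each.\<close>
  define p :: "real \<times> real \<times> real \<Rightarrow> real" where
    "p = (\<lambda>v. (fst v + fst v ^ 2 * (8 * fst (snd v) + 1) ^ 4) * (3 * (2 + (8 * fst (snd v) + snd (snd v)))))"
  have lin: "bounded_linear (\<lambda>v :: real \<times> real \<times> real. fst v)"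
    "bounded_linear (\<lambda>v :: real \<times> real \<times> real. fst (snd v))"
    "bounded_linear (\<lambda>v :: real \<times> real \<times> real. snd (snd v))"
    by (intro bounded_linear_fst bounded_linear_snd bounded_linear_fst_comp bounded_linear_snd_comp)+
  have "real_polynomial_function p"
    unfolding p_def using lin by (intro real_polynomial_function.intros real_polynomial_function_power)
  moreover have "\<exists>m' A' b'. is_description m' A' b' (split_closure P) \<and>
      real (encoding_size A' b') \<le> p (real m, log_plus2 (mat_norm_inf A), log_plus2 (vec_norm_inf b))"
    if "is_description m A b P" for m A b P
  proof -
    define \<alpha> B where "\<alpha> = mat_norm_inf A" and "B = vec_norm_inf b"
    define x y where "x = log_plus2 \<alpha>" and "y = log_plus2 B"
    have nn: "0 \<le> \<alpha>" "0 \<le> B" using norm_inf_nonneg by (auto simp: \<alpha>_def B_def)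
    have x1: "1 \<le> x" using nn by (simp add: x_def log_plus2_def)
    have len: "length A = m" "length b = m" using that by (auto simp: is_description_def)
    have P: "P = (\<Inter>i\<in>{..<m}. halfplane (A ! i) (b ! i))"
      using that by (auto simp: is_description_def halfplane_def)
    have Abd: "\<bar>A ! i $ j\<bar> \<le> \<alpha>" "\<bar>b ! i\<bar> \<le> B" if "i < m" for i j
      using that len abs_entry_le_mat_norm_inf[of "A ! i" A j] abs_entry_le_vec_norm_inf[of "b ! i" b]
      by (auto simp: \<alpha>_def B_def)
    define K where "K = (2 * nat (bitlen (2 * \<alpha>\<^sup>2)) + 1) ^ 4"
    \<comment> \<open>A common bound for all entries. With \<open>u = 2 + \<alpha>\<close>, the
      powers of two in \<open>8 * \<alpha> ^ 5\<close> and
      \<open>4 * \<alpha> ^ 4 * (2 * B + 1)\<close> are absorbed by extra factors \<open>u\<close>,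
      using \<open>2 * B + 1 \<le> 2 * (2 + B)\<close>; this leads to the exponent 8.\<close>
    define M where "M = (2 + real_of_int \<alpha>) ^ 8 * (2 + real_of_int B)"
    have "\<forall>i. \<exists>r. split_closure (halfplane (A ! i) (b ! i)) = halfplane (fst r) (snd r) \<and>
        (\<forall>j. \<bar>fst r $ j\<bar> \<le> \<bar>A ! i $ j\<bar>) \<and> \<bar>snd r\<bar> \<le> \<bar>b ! i\<bar>"
      by (metis fst_conv snd_conv split_closure_halfplane)
    then obtain r where r: "\<And>i. split_closure (halfplane (A ! i) (b ! i)) = halfplane (fst (r i)) (snd (r i))"
      "\<And>i j. \<bar>fst (r i) $ j\<bar> \<le> \<bar>A ! i $ j\<bar>" "\<And>i. \<bar>snd (r i)\<bar> \<le> \<bar>b ! i\<bar>"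
      by metis
    define I where "I = {(i, j). i \<in> {..<m} \<and> j \<in> {..<m} \<and> 0 < det2 (A ! i) (A ! j)}"
    have I: "I \<subseteq> {..<m} \<times> {..<m}" "finite I" unfolding I_def
      by (auto intro: finite_subset[of _ "{..<m} \<times> {..<m}"])
    have detle: "\<bar>det2 (A ! i) (A ! j)\<bar> \<le> 2 * \<alpha>\<^sup>2" if "(i, j) \<in> I" for i j
      using that Abd by (intro abs_det2_le) (auto simp: I_def)
    have "\<exists>R. finite R \<and> card R \<le> K \<and>
      split_closure (halfplane (A ! i) (b ! i) \<inter> halfplane (A ! j) (b ! j)) =
        halfplane (A ! i) (b ! i) \<inter> halfplane (A ! j) (b ! j) \<inter> (\<Inter>(c, \<gamma>)\<in>R. halfplane c \<gamma>) \<and>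
      (\<forall>c \<gamma> k. (c, \<gamma>) \<in> R \<longrightarrow> \<bar>c $ k\<bar> \<le> 8 * \<alpha> ^ 5 \<and> \<bar>\<gamma>\<bar> \<le> 4 * \<alpha> ^ 4 * (2 * B + 1))"
      if ij: "(i, j) \<in> I" for i j
    proof -
      have D: "0 < det2 (A ! i) (A ! j)" "i < m" "j < m" using ij by (auto simp: I_def)
      obtain R where R: "finite R" "card R \<le> (2 * nat (bitlen (det2 (A ! i) (A ! j))) + 1) ^ 4"
        "split_closure (halfplane (A ! i) (b ! i) \<inter> halfplane (A ! j) (b ! j)) =
        halfplane (A ! i) (b ! i) \<inter> halfplane (A ! j) (b ! j) \<inter> (\<Inter>(c, \<gamma>)\<in>R. halfplane c \<gamma>)"
        "\<And>c \<gamma> k. (c, \<gamma>) \<in> R \<Longrightarrow> \<bar>c $ k\<bar> \<le> 2 * (det2 (A ! i) (A ! j))\<^sup>2 * \<alpha>"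
        "\<And>c \<gamma>. (c, \<gamma>) \<in> R \<Longrightarrow> \<bar>\<gamma>\<bar> \<le> 2 * (det2 (A ! i) (A ! j))\<^sup>2 * B + (det2 (A ! i) (A ! j))\<^sup>2"
        using split_closure_cone[OF D(1) Abd(1)[OF D(2)] Abd(1)[OF D(3)] Abd(2)[OF D(2)] Abd(2)[OF D(3)]] by metis
      have "bitlen (det2 (A ! i) (A ! j)) \<le> bitlen (2 * \<alpha>\<^sup>2)"
        using detle[OF ij] D(1) unfolding bitlen_def by (simp add: floorlog_mono)
      then have Kb: "(2 * nat (bitlen (det2 (A ! i) (A ! j))) + 1) ^ 4 \<le> K"
        unfolding K_def by (intro power_mono) auto
      have sq: "(det2 (A ! i) (A ! j))\<^sup>2 \<le> 4 * \<alpha> ^ 4"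
        using power_mono[of "det2 (A ! i) (A ! j)" "2 * \<alpha>\<^sup>2" 2] detle[OF ij] D(1)
        by (simp add: power_mult_distrib flip: power_mult)
      have "2 * (det2 (A ! i) (A ! j))\<^sup>2 * \<alpha> \<le> 2 * (4 * \<alpha> ^ 4) * \<alpha>"
        using sq nn by (intro mult_right_mono) auto
      also have "\<dots> = 8 * \<alpha> ^ 5" by (simp add: eval_nat_numeral)
      finally have b1: "2 * (det2 (A ! i) (A ! j))\<^sup>2 * \<alpha> \<le> 8 * \<alpha> ^ 5" .
      have "(det2 (A ! i) (A ! j))\<^sup>2 * (2 * B + 1) \<le> 4 * \<alpha> ^ 4 * (2 * B + 1)"
        using sq nn by (intro mult_right_mono) auto
      then have b2: "2 * (det2 (A ! i) (A ! j))\<^sup>2 * B + (det2 (A ! i) (A ! j))\<^sup>2 \<le> 4 * \<alpha> ^ 4 * (2 * B + 1)"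
        by (simp add: algebra_simps)
      show ?thesis
        using R(1,3) order_trans[OF R(2) Kb] order_trans[OF R(4) b1] order_trans[OF R(5) b2]
        by (intro exI[of _ R]) blast
    qed
    then have "\<forall>ij. \<exists>R. ij \<in> I \<longrightarrow> finite R \<and> card R \<le> K \<and>
      split_closure (halfplane (A ! fst ij) (b ! fst ij) \<inter> halfplane (A ! snd ij) (b ! snd ij)) =
        halfplane (A ! fst ij) (b ! fst ij) \<inter> halfplane (A ! snd ij) (b ! snd ij) \<inter> (\<Inter>(c, \<gamma>)\<in>R. halfplane c \<gamma>) \<and>
      (\<forall>c \<gamma> k. (c, \<gamma>) \<in> R \<longrightarrow> \<bar>c $ k\<bar> \<le> 8 * \<alpha> ^ 5 \<and> \<bar>\<gamma>\<bar> \<le> 4 * \<alpha> ^ 4 * (2 * B + 1))"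
      by (metis prod.collapse)
    from choice[OF this] obtain R where R0: "\<forall>ij. ij \<in> I \<longrightarrow> finite (R ij) \<and> card (R ij) \<le> K \<and>
      split_closure (halfplane (A ! fst ij) (b ! fst ij) \<inter> halfplane (A ! snd ij) (b ! snd ij)) =
        halfplane (A ! fst ij) (b ! fst ij) \<inter> halfplane (A ! snd ij) (b ! snd ij) \<inter> (\<Inter>(c, \<gamma>)\<in>R ij. halfplane c \<gamma>) \<and>
      (\<forall>c \<gamma> k. (c, \<gamma>) \<in> R ij \<longrightarrow> \<bar>c $ k\<bar> \<le> 8 * \<alpha> ^ 5 \<and> \<bar>\<gamma>\<bar> \<le> 4 * \<alpha> ^ 4 * (2 * B + 1))"
      by blast
    have Rfin: "finite (R ij)" and Rcard: "card (R ij) \<le> K"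
      and Rbd: "\<And>c \<gamma> k. (c, \<gamma>) \<in> R ij \<Longrightarrow> \<bar>c $ k\<bar> \<le> 8 * \<alpha> ^ 5 \<and> \<bar>\<gamma>\<bar> \<le> 4 * \<alpha> ^ 4 * (2 * B + 1)"
      if "ij \<in> I" for ij
      using R0 that by blast+
    have Rcl: "split_closure (halfplane (A ! i) (b ! i) \<inter> halfplane (A ! j) (b ! j)) =
        halfplane (A ! i) (b ! i) \<inter> halfplane (A ! j) (b ! j) \<inter> (\<Inter>(c, \<gamma>)\<in>R (i, j). halfplane c \<gamma>)"
      if "(i, j) \<in> I" for i j
      using R0[rule_format, OF that] by simp
    define S where "S = r ` {..<m} \<union> (\<Union>ij\<in>I. R ij)"
    have "finite S" unfolding S_def using I Rfin by auto
    have single: "split_closure (halfplane (A ! i) (b ! i)) \<subseteq> halfplane (A ! i) (b ! i)" for i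
      by (rule split_closure_subset[OF convex_halfplane])
    have closure: "split_closure P = (\<Inter>(c, \<gamma>)\<in>S. halfplane c \<gamma>)"
    proof -
      have "split_closure P = (\<Inter>i\<in>{..<m}. split_closure (halfplane (A ! i) (b ! i))) \<inter>
        (\<Inter>(i, j)\<in>I. split_closure (halfplane (A ! i) (b ! i) \<inter> halfplane (A ! j) (b ! j)))"
        unfolding P I_def by (rule split_closure_halfplanes) simp
      also have "\<dots> = (\<Inter>i\<in>{..<m}. split_closure (halfplane (A ! i) (b ! i))) \<inter>
        (\<Inter>(i, j)\<in>I. halfplane (A ! i) (b ! i) \<inter> halfplane (A ! j) (b ! j) \<inter> (\<Inter>(c, \<gamma>)\<in>R (i, j). halfplane c \<gamma>))"
        using Rcl by (intro arg_cong2[where f = "(\<inter>)"] INF_cong) auto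
      \<comment> \<open>The inequalities of the cones themselves follow from the rounded single
        inequalities.\<close>
      also have "\<dots> = (\<Inter>i\<in>{..<m}. split_closure (halfplane (A ! i) (b ! i))) \<inter>
        (\<Inter>(i, j)\<in>I. \<Inter>(c, \<gamma>)\<in>R (i, j). halfplane c \<gamma>)"
        using single I(1) by fastforce
      also have "\<dots> = (\<Inter>(c, \<gamma>)\<in>S. halfplane c \<gamma>)"
        unfolding r(1) S_def by (auto simp: split_beta)
      finally show ?thesis .
    qed
    have cardS: "card S \<le> m + m\<^sup>2 * K"
    proof -
      have "card (\<Union>ij\<in>I. R ij) \<le> (\<Sum>ij\<in>I. card (R ij))" by (rule card_UN_le[OF I(2)])
      also have "\<dots> \<le> card I * K" using sum_bounded_above[of I "\<lambda>ij. card (R ij)" K] Rcard by simp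
      also have "\<dots> \<le> m\<^sup>2 * K"
        using card_mono[OF _ I(1)] by (intro mult_right_mono) (auto simp: power2_eq_square)
      finally have "card (\<Union>ij\<in>I. R ij) \<le> m\<^sup>2 * K" .
      moreover have "card (r ` {..<m}) \<le> m" using card_image_le[of "{..<m}" r] by simp
      ultimately show ?thesis using card_Un_le[of "r ` {..<m}" "\<Union>ij\<in>I. R ij"] unfolding S_def by linarith
    qed
    define u where "u = 2 + real_of_int \<alpha>"
    have u: "2 \<le> u" "real_of_int \<alpha> \<le> u" using nn by (auto simp: u_def)
    have logu: "log 2 u = x" by (simp add: u_def x_def log_plus2_def)
    have pw: "c * real_of_int \<alpha> ^ n \<le> u ^ (k + n)" if "c \<le> 2 ^ k" "0 \<le> c" for c n k
    proof -
      have "c \<le> u ^ k" using that power_mono[of 2 u k] u by simp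
      then show ?thesis unfolding power_add using u nn that by (intro mult_mono power_mono) auto
    qed
    have Kle: "real K \<le> (8 * x + 1) ^ 4"
    proof -
      \<comment> \<open>The bit length is at most \<open>1 + log 2 (u ^ 3) = 1 + 3 * x\<close>, and
        \<open>1 \<le> x\<close> absorbs the summand 1.\<close>
      have "real (nat (bitlen (2 * \<alpha>\<^sup>2))) \<le> 4 * x"
      proof (cases "\<alpha> = 0")
        case True
        then show ?thesis using x1 by simp
      next
        case False
        then have pos: "0 < 2 * \<alpha>\<^sup>2" by simp
        have "real (nat (bitlen (2 * \<alpha>\<^sup>2))) \<le> 1 + log 2 (real_of_int (2 * \<alpha>\<^sup>2))"
          using pos bitlen_nonneg[of "2 * \<alpha>\<^sup>2"] by (simp add: bitlen_alt_def)
        also have "real_of_int (2 * \<alpha>\<^sup>2) \<le> u ^ 3" using pw[of 2 1 2] by (simp add: eval_nat_numeral)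
        then have "log 2 (real_of_int (2 * \<alpha>\<^sup>2)) \<le> log 2 (u ^ 3)" using pos by (intro log_mono) auto
        also have "log 2 (u ^ 3) = 3 * x" using u by (simp add: log_nat_power logu)
        finally show ?thesis using x1 by simp
      qed
      then have "(2 * real (nat (bitlen (2 * \<alpha>\<^sup>2))) + 1) ^ 4 \<le> (8 * x + 1) ^ 4"
        by (intro power_mono) auto
      then show ?thesis by (simp add: K_def add.commute)
    qed
    have up: "u ^ i \<le> M" if "i \<le> 7" for i
    proof -
      have "u ^ i \<le> u ^ 8" using u that by (intro power_increasing) auto
      also have "\<dots> \<le> u ^ 8 * (2 + real_of_int B)" using u nn by simp
      finally show ?thesis by (simp add: M_def u_def)
    qed
    have M1: "1 \<le> M" using up[of 0] by simp
    have logM: "log 2 M = 8 * x + y"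
      unfolding M_def using u nn by (simp add: log_mult log_nat_power x_def y_def log_plus2_def)
    have bound: "real_of_int \<bar>c $ k\<bar> \<le> M \<and> real_of_int \<bar>\<gamma>\<bar> \<le> M" if "(c, \<gamma>) \<in> S" for c \<gamma> k
    proof -
      consider i where "i < m" "(c, \<gamma>) = r i" | ij where "ij \<in> I" "(c, \<gamma>) \<in> R ij"
        using \<open>(c, \<gamma>) \<in> S\<close> unfolding S_def by blast
      then show ?thesis
      proof cases
        case 1
        have "\<bar>c $ k\<bar> \<le> \<alpha>" "\<bar>\<gamma>\<bar> \<le> B"
          using r(2)[of i k] r(3)[of i] Abd[OF 1(1)] 1(2) by (metis fst_conv order_trans, metis snd_conv order_trans)
        then have "real_of_int \<bar>c $ k\<bar> \<le> u ^ 1" "real_of_int \<bar>\<gamma>\<bar> \<le> 1 * (2 + real_of_int B)"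
          using u by auto
        moreover have "1 * (2 + real_of_int B) \<le> M"
          unfolding M_def using nn by (intro mult_right_mono one_le_power) auto
        ultimately show ?thesis using up[of 1] by linarith
      next
        case 2
        have c: "\<bar>c $ k\<bar> \<le> 8 * \<alpha> ^ 5" and g: "\<bar>\<gamma>\<bar> \<le> 4 * \<alpha> ^ 4 * (2 * B + 1)"
          using Rbd[OF 2] by auto
        have "real_of_int \<bar>c $ k\<bar> \<le> real_of_int (8 * \<alpha> ^ 5)" using c by (simp only: of_int_le_iff)
        also have "\<dots> = 8 * real_of_int \<alpha> ^ 5" by simp
        also have "\<dots> \<le> u ^ 8" using pw[of 8 3 5] by simp
        also have "\<dots> \<le> M" unfolding M_def u_def using nn by simp
        finally have 1: "real_of_int \<bar>c $ k\<bar> \<le> M" .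
        have "real_of_int \<bar>\<gamma>\<bar> \<le> real_of_int (4 * \<alpha> ^ 4 * (2 * B + 1))" using g by (simp only: of_int_le_iff)
        also have "\<dots> = 4 * real_of_int \<alpha> ^ 4 * (2 * real_of_int B + 1)" by simp
        also have "\<dots> \<le> 4 * real_of_int \<alpha> ^ 4 * (2 * (2 + real_of_int B))"
          using nn by (intro mult_left_mono) auto
        also have "\<dots> = 8 * real_of_int \<alpha> ^ 4 * (2 + real_of_int B)" by simp
        also have "\<dots> \<le> u ^ 8 * (2 + real_of_int B)"
        proof -
          have "8 * real_of_int \<alpha> ^ 4 \<le> u ^ 8" using pw[of 8 4 4] by simp
          then show ?thesis using nn by (intro mult_right_mono) auto
        qed
        finally show ?thesis using 1 by (simp add: M_def u_def)
      qed
    qed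
    obtain rows where rows: "set rows = S" "distinct rows" using finite_distinct_list[OF \<open>finite S\<close>] by blast
    have "is_description (length rows) (map fst rows) (map snd rows) (split_closure P)"
    proof -
      have "(\<Inter>(c, \<gamma>)\<in>S. halfplane c \<gamma>) = {z. \<forall>q\<in>set rows. real_vec (fst q) \<bullet> z \<le> real_of_int (snd q)}"
        unfolding rows(1) by (auto simp: halfplane_def split_beta)
      then show ?thesis unfolding is_description_def closure by (auto simp: all_set_conv_all_nth)
    qed
    moreover have "real (encoding_size (map fst rows) (map snd rows)) \<le> p (real m, x, y)"
    proof -
      have "real (encoding_size (map fst rows) (map snd rows)) \<le> real (length rows) * (3 * (2 + log 2 M))"
        using bound int_bits_le M1 by (intro encoding_size_le) (auto simp: rows(1))
      also have "real (length rows) = real (card S)" using distinct_card[OF rows(2)] rows(1) by simp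
      also have "real (card S) * (3 * (2 + log 2 M)) \<le> (real m + (real m)\<^sup>2 * (8 * x + 1) ^ 4) * (3 * (2 + log 2 M))"
      proof (rule mult_right_mono)
        have "real (card S) \<le> real m + (real m)\<^sup>2 * real K"
          using of_nat_mono[OF cardS, where 'a = real] by simp
        also have "\<dots> \<le> real m + (real m)\<^sup>2 * (8 * x + 1) ^ 4"
          using Kle by (intro add_left_mono mult_left_mono) auto
        finally show "real (card S) \<le> real m + (real m)\<^sup>2 * (8 * x + 1) ^ 4" .
        show "0 \<le> 3 * (2 + log 2 M)" using M1 by simp
      qed
      finally show ?thesis by (simp add: p_def logM)
    qed
    ultimately show ?thesis unfolding x_def y_def \<alpha>_def B_def by blast
  qed
  ultimately show ?thesis by blast
qed

end
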